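(* Let $g_1,\dots,g_m:\mathbb{R}^n\to\mathbb{R}$ be differentiable functions that are definable in the same o-minimal structure on $(\mathbb{R},+,\cdot)$. For $\mu\in\mathbb{R}^m$ let $C_\mu=\{x\in\mathbb{R}^n \mid g_1(x)\le\mu_1,\dots,g_m(x)\le\mu_m\}$. (i) (Outer regular perturbations.) If $C_0=\{x \mid g_1(x)\le 0,\dots,g_m(x)\le 0\}$ is nonempty, then there exists $\varepsilon_0>0$ such that $(0,\varepsilon_0)^m\subset\mathcal{A}_{\mathrm{reg}}$. In other words, for all $\mu\in(0,\varepsilon_0)^m$, the set $C_\mu$ is nonempty and the Mangasarian-Fromovitz constraint qualification holds at every point of $C_\mu$. (ii) (Inner regular perturbations.) If $\{x \mid g_1(x)<0,\dots,g_m(x)<0\}$ is nonempty, then there exists $\varepsilon_1>0$ such that $(-\varepsilon_1,0)^m\subset\mathcal{A}_{\mathrm{reg}}$. In other words, for all $\mu\in(-\varepsilon_1,0)^m$, the set $C_\mu$ is nonempty and the Mangasarian-Fromovitz constraint qualification holds at every point of $C_\mu$.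
   Context: An o-minimal structure on $(\mathbb{R},+,\cdot)$ is a sequence $(\mathcal{O}_p)_{p\in\mathbb{N}}$ where each $\mathcal{O}_p$ is a Boolean algebra of subsets of $\mathbb{R}^p$ such that: if $A\in\mathcal{O}_p$ then $A\times\mathbb{R},\ \mathbb{R}\times A\in\mathcal{O}_{p+1}$; if $A\in\mathcal{O}_{p+1}$ then its projection on the first $p$ coordinates is in $\mathcal{O}_p$; $\mathcal{O}_p$ contains all zero sets of real polynomials on $\mathbb{R}^p$; and the elements of $\mathcal{O}_1$ are exactly the finite unions of points and intervals. A set is definable if it belongs to the structure; a function is definable if its graph is. A point $x\in C_\mu$ satisfies the Mangasarian-Fromovitz constraint qualification (MFCQ) for $C_\mu$ if there exists $y\in\mathbb{R}^n$ with $\langle y,\nabla g_i(x)\rangle<0$ for every active index $i\in I(x)=\{1\le i\le m \mid g_i(x)=\mu_i\}$ (vacuous if $I(x)=\emptyset$). $\mathcal{A}=\{\mu\in\mathbb{R}^m \mid C_\mu\ne\emptyset\}$ is the set of admissible perturbations and $\mathcal{A}_{\mathrm{reg}}=\{\mu\in\mathcal{A} \mid \text{MFCQ holds at every } x\in C_\mu\}$ is the set of regular perturbations. *)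

theory Defs
  imports "HOL-Analysis.Analysis"
begin

section \<open>O-minimal structures\<close>

text \<open>The dimension of the ambient space varies within an o-minimal structure, so the points of
  \<open>\<real>\<^sup>p\<close> are represented here by the real lists of length \<open>p\<close>.\<close>

definition Rpow :: "nat \<Rightarrow> real list set" where
  "Rpow p = {xs. length xs = p}"

text \<open>A polynomial function in \<open>p\<close> variables: a finite linear combination of monomials. The finite
  set \<open>M\<close> holds the exponent vectors \<open>a\<close>, of which only the entries \<open>a i\<close> with \<open>i < p\<close> matter.\<close>

definition polynomial_on_Rpow :: "nat \<Rightarrow> (real list \<Rightarrow> real) \<Rightarrow> bool" where
  "polynomial_on_Rpow p f \<longleftrightarrow>
     (\<exists>(M :: (nat \<Rightarrow> nat) set) (c :: (nat \<Rightarrow> nat) \<Rightarrow> real). finite M \<and>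
        (\<forall>xs\<in>Rpow p. f xs = (\<Sum>a\<in>M. c a * (\<Prod>i<p. (xs ! i) ^ a i))))"

locale o_minimal_structure =
  fixes S :: "nat \<Rightarrow> real list set set"
  assumes boolean_algebra: "\<And>p. algebra (Rpow p) (S p)"
    and times_line: "\<And>p A. A \<in> S p \<Longrightarrow> {xs @ [t] | xs t. xs \<in> A} \<in> S (Suc p)"
    and line_times: "\<And>p A. A \<in> S p \<Longrightarrow> {t # xs | t xs. xs \<in> A} \<in> S (Suc p)"
    and projection: "\<And>p A. A \<in> S (Suc p) \<Longrightarrow> butlast ` A \<in> S p"
    and zero_sets: "\<And>p f. polynomial_on_Rpow p f \<Longrightarrow> {xs \<in> Rpow p. f xs = 0} \<in> S p"
    and dimension_one:
      "\<And>A. A \<in> S 1 \<longleftrightarrow>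
         (\<exists>\<I> :: real set set. finite \<I> \<and> (\<forall>I\<in>\<I>. (\<exists>a. I = {a}) \<or> is_interval I) \<and>
            A = (\<lambda>t. [t]) ` \<Union>\<I>)"

text \<open>The type \<open>real ^ 'n\<close> has no distinguished order of coordinates. An enumeration \<open>e\<close> of the
  index type (a bijection from \<open>{..<CARD('n)}\<close> onto it) identifies \<open>real ^ 'n\<close> with \<open>\<real>\<^sup>n\<close>,
  \<open>n = CARD('n)\<close>.\<close>

definition coords :: "(nat \<Rightarrow> 'n::finite) \<Rightarrow> real ^ 'n \<Rightarrow> real list" where
  "coords e x = map (\<lambda>k. x $ e k) [0..<CARD('n)]"

definition definable_fun ::
  "(nat \<Rightarrow> real list set set) \<Rightarrow> (nat \<Rightarrow> 'n::finite) \<Rightarrow> (real ^ 'n \<Rightarrow> real) \<Rightarrow> bool" where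
  "definable_fun S e f \<longleftrightarrow> {coords e x @ [f x] | x. True} \<in> S (Suc CARD('n))"


section \<open>Constraint sets and regular perturbations\<close>

definition gradient :: "('a::real_inner \<Rightarrow> real) \<Rightarrow> 'a \<Rightarrow> 'a" where
  "gradient f x = (THE D. GDERIV f x :> D)"

lemma gradient_eqI:
  assumes "GDERIV f x :> D"
  shows "gradient f x = D"
  unfolding gradient_def
proof (rule the_equality)
  fix D' assume "GDERIV f x :> D'"
  then have "(\<lambda>h. inner h D') = (\<lambda>h. inner h D)"
    using assms unfolding gderiv_def by (rule has_derivative_unique)
  then have "inner (D' - D) D' = inner (D' - D) D"
    by (rule fun_cong)
  then have "inner (D' - D) (D' - D) = 0"
    by (simp add: inner_diff_right)
  then show "D' = D" by simp
qed (rule assms)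

lemma GDERIV_gradient:
  fixes f :: "'a::euclidean_space \<Rightarrow> real"
  assumes "f differentiable (at x)"
  shows "GDERIV f x :> gradient f x"
proof -
  from assms obtain f' where f': "(f has_derivative f') (at x)"
    by (auto simp: differentiable_def)
  then have "linear f'" by (rule has_derivative_linear)
  then have "f' = (\<lambda>h. inner h (adjoint f' 1))"
    using adjoint_works[of f'] by (auto simp: fun_eq_iff)
  with f' have "GDERIV f x :> adjoint f' 1" by (simp add: gderiv_def)
  then show ?thesis using gradient_eqI by metis
qed

definition constraint_set :: "('m::finite \<Rightarrow> real ^ 'n \<Rightarrow> real) \<Rightarrow> real ^ 'm \<Rightarrow> (real ^ 'n) set" where
  "constraint_set g \<mu> = {x. \<forall>i. g i x \<le> \<mu> $ i}"

definition active :: "('m::finite \<Rightarrow> real ^ 'n \<Rightarrow> real) \<Rightarrow> real ^ 'm \<Rightarrow> real ^ 'n \<Rightarrow> 'm set" where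
  "active g \<mu> x = {i. g i x = \<mu> $ i}"

definition MFCQ :: "('m::finite \<Rightarrow> real ^ 'n \<Rightarrow> real) \<Rightarrow> real ^ 'm \<Rightarrow> real ^ 'n \<Rightarrow> bool" where
  "MFCQ g \<mu> x \<longleftrightarrow> (\<exists>y. \<forall>i\<in>active g \<mu> x. y \<bullet> gradient (g i) x < 0)"

definition admissible :: "('m::finite \<Rightarrow> real ^ 'n \<Rightarrow> real) \<Rightarrow> (real ^ 'm) set" where
  "admissible g = {\<mu>. constraint_set g \<mu> \<noteq> {}}"

definition regular :: "('m::finite \<Rightarrow> real ^ 'n \<Rightarrow> real) \<Rightarrow> (real ^ 'm) set" where
  "regular g = {\<mu> \<in> admissible g. \<forall>x\<in>constraint_set g \<mu>. MFCQ g \<mu> x}"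

end

theory Submission
  imports Defs
begin

text \<open>The failure of the constraint qualification at \<open>x\<close> means, by separation, that \<open>0\<close> is a convex combination
of the gradients of the active constraints: there are multipliers \<open>l \<ge> 0\<close>, \<open>l \<noteq> 0\<close>, such that
\<open>\<phi> = (\<Sum>i. l\<^sub>i * g\<^sub>i)\<close> has derivative zero at \<open>x\<close> and \<open>g\<^sub>i x = \<mu>\<^sub>i\<close> whenever \<open>l\<^sub>i > 0\<close>
(\<open>critical_values_if_not_MFCQ\<close>). So both claims reduce to a Sard-type statement: for small \<open>\<epsilon>\<close> there is no
such pair \<open>(x, l)\<close> with \<open>g\<^sub>i x \<in> {0<..<\<epsilon>}\<close> for all \<open>i\<close> in the support of \<open>l\<close>
(\<open>no_small_positive_critical_values\<close>); the inner perturbations are covered by applying it to \<open>- g\<close>.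

Suppose that such pairs exist for every \<open>\<epsilon>\<close>. The set of all values \<open>t = Max {g\<^sub>i x | l\<^sub>i > 0}\<close> taken over these
pairs is definable and accumulates at \<open>0\<close>, so it contains an interval \<open>{0<..<\<delta>}\<close>, and definable choice gives
a curve \<open>X t\<close> of points carrying multipliers with maximum exactly \<open>t\<close>. Put \<open>h\<^sub>i t = g\<^sub>i (X t)\<close>. For
\<open>s\<close> slightly larger than a suitable small \<open>t\<close>, every \<open>h\<^sub>i\<close> with \<open>l\<^sub>i > 0\<close> satisfies
\<open>h\<^sub>i s \<ge> h\<^sub>i t\<close>, because it lies between \<open>0\<close> and the identity near \<open>0\<close>; and for an index \<open>j\<close> attaining
the maximum, \<open>h\<^sub>j\<close> is the identity. So \<open>\<phi>\<close> grows by at least \<open>l\<^sub>j * (s - t)\<close> along the curve. But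
\<open>\<phi>\<close> has derivative zero at \<open>X t\<close>, so it grows by \<open>o(\<bar>X s - X t\<bar>)\<close>, which is \<open>o(s - t)\<close> as soon as \<open>X\<close> is
Lipschitz at \<open>t\<close> from the right: a contradiction.

The whole argument needs only two facts about an o-minimal structure: definable sets are closed under first-order
formulas, and on each side of a point of the line either a definable set or its complement contains a punctured
neighbourhood of that point (\<open>at_right_dichotomy\<close>, \<open>at_left_dichotomy\<close>). The
monotonicity theorem is replaced by the observation that a real function has only countably many strict local
minima: if a definable \<open>f\<close> increases locally to the right of every small \<open>t\<close>, then by the dichotomy on the left
either all these \<open>t\<close> are strict local minima, which is impossible, or \<open>f\<close> is monotone near \<open>0\<close>
(\<open>increasing_near_zero\<close>). A monotone function cannot have infinite right slope at every point of an interval,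
which gives the right Lipschitz property (\<open>right_lipschitz_near_zero\<close>).\<close>

section \<open>Cylinders, projections and polynomials\<close>

named_theorems definability

context o_minimal_structure
begin

lemma subset_Rpow: "A \<in> S p \<Longrightarrow> A \<subseteq> Rpow p"
proof -
  interpret algebra "Rpow p" "S p" by (rule boolean_algebra)
  show "A \<in> S p \<Longrightarrow> A \<subseteq> Rpow p" by (rule sets_into_space)
qed

lemma length_mem: "A \<in> S p \<Longrightarrow> xs \<in> A \<Longrightarrow> length xs = p"
  using subset_Rpow by (auto simp: Rpow_def)

lemma Rpow_mem: "Rpow p \<in> S p"
proof -
  interpret algebra "Rpow p" "S p" by (rule boolean_algebra)
  show ?thesis by (rule top)
qed

lemma Int_mem: "A \<in> S p \<Longrightarrow> B \<in> S p \<Longrightarrow> A \<inter> B \<in> S p"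
proof -
  interpret algebra "Rpow p" "S p" by (rule boolean_algebra)
  show "A \<in> S p \<Longrightarrow> B \<in> S p \<Longrightarrow> A \<inter> B \<in> S p" by (rule Int)
qed

lemma Diff_mem: "A \<in> S p \<Longrightarrow> B \<in> S p \<Longrightarrow> A - B \<in> S p"
proof -
  interpret algebra "Rpow p" "S p" by (rule boolean_algebra)
  show "A \<in> S p \<Longrightarrow> B \<in> S p \<Longrightarrow> A - B \<in> S p" by (rule Diff)
qed

lemma finite_Inter_mem:
  assumes "finite I" "\<And>i. i \<in> I \<Longrightarrow> A i \<in> S p"
  shows "Rpow p \<inter> (\<Inter>i\<in>I. A i) \<in> S p"
  using assms
proof (induction I rule: finite_induct)
  case empty
  then show ?case using Rpow_mem by simp
next
  case (insert j I)
  then have "A j \<inter> (Rpow p \<inter> (\<Inter>i\<in>I. A i)) \<in> S p" by (intro Int_mem[of _ _ "Rpow p \<inter> _"]) auto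
  moreover have "A j \<inter> (Rpow p \<inter> (\<Inter>i\<in>I. A i)) = Rpow p \<inter> (\<Inter>i\<in>insert j I. A i)" by auto
  ultimately show ?case by simp
qed

lemma append_Rpow_mem: "A \<in> S p \<Longrightarrow> {xs @ zs | xs zs. xs \<in> A \<and> length zs = q} \<in> S (p + q)"
proof (induction q)
  case 0
  then show ?case by simp
next
  case (Suc q)
  let ?B = "{xs @ zs | xs zs. xs \<in> A \<and> length zs = q}"
  have "{xs @ zs | xs zs. xs \<in> A \<and> length zs = Suc q} = {ys @ [t] | ys t. ys \<in> ?B}"
  proof (intro set_eqI iffI)
    fix ws assume "ws \<in> {xs @ zs | xs zs. xs \<in> A \<and> length zs = Suc q}"
    then obtain xs zs t where "ws = (xs @ zs) @ [t]" "xs \<in> A" "length zs = q"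
      by (auto simp: length_Suc_conv_rev)
    then show "ws \<in> {ys @ [t] | ys t. ys \<in> ?B}" by blast
  next
    fix ws assume "ws \<in> {ys @ [t] | ys t. ys \<in> ?B}"
    then obtain xs zs t where "ws = xs @ (zs @ [t])" "xs \<in> A" "length (zs @ [t]) = Suc q"
      by auto
    then show "ws \<in> {xs @ zs | xs zs. xs \<in> A \<and> length zs = Suc q}" by blast
  qed
  with times_line[OF Suc.IH[OF Suc.prems]] show ?case by simp
qed

lemma prepend_Rpow_mem: "A \<in> S p \<Longrightarrow> {zs @ xs | zs xs. xs \<in> A \<and> length zs = q} \<in> S (q + p)"
proof (induction q)
  case 0
  then show ?case by simp
next
  case (Suc q)
  let ?B = "{zs @ xs | zs xs. xs \<in> A \<and> length zs = q}"
  have "{zs @ xs | zs xs. xs \<in> A \<and> length zs = Suc q} = {t # ys | t ys. ys \<in> ?B}"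
  proof (intro set_eqI iffI)
    fix ws assume "ws \<in> {zs @ xs | zs xs. xs \<in> A \<and> length zs = Suc q}"
    then obtain t zs xs where "ws = t # (zs @ xs)" "xs \<in> A" "length zs = q"
      by (auto simp: length_Suc_conv)
    then show "ws \<in> {t # ys | t ys. ys \<in> ?B}" by blast
  next
    fix ws assume "ws \<in> {t # ys | t ys. ys \<in> ?B}"
    then obtain t zs xs where "ws = (t # zs) @ xs" "xs \<in> A" "length (t # zs) = Suc q"
      by auto
    then show "ws \<in> {zs @ xs | zs xs. xs \<in> A \<and> length zs = Suc q}" by blast
  qed
  with line_times[OF Suc.IH[OF Suc.prems]] show ?case by simp
qed

lemma take_mem: "A \<in> S (q + p) \<Longrightarrow> take q ` A \<in> S q"
proof (induction p arbitrary: A)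
  case 0
  then have "take q ` A = A" using length_mem[OF 0] by (force simp: image_iff)
  with 0 show ?case by simp
next
  case (Suc p)
  then have *: "butlast ` A \<in> S (q + p)" using projection by simp
  have "take q (butlast xs) = take q xs" if "xs \<in> A" for xs
    using length_mem[OF Suc.prems that] by (simp add: take_butlast)
  then have "take q ` A = take q ` butlast ` A" by (auto simp: image_iff)
  with Suc.IH[OF *] show ?case by simp
qed

end

lemma polynomial_monomial: "polynomial_on_Rpow p (\<lambda>xs. c * (\<Prod>i<p. (xs ! i) ^ a i))"
  unfolding polynomial_on_Rpow_def by (rule exI[of _ "{a}"], rule exI[of _ "\<lambda>_. c"]) simp

lemma polynomial_const: "polynomial_on_Rpow p (\<lambda>xs. c)"
  using polynomial_monomial[of p c "\<lambda>_. 0"] by simp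

lemma polynomial_var:
  assumes "k < p"
  shows "polynomial_on_Rpow p (\<lambda>xs. c * xs ! k)"
proof -
  have *: "(\<Prod>i<p. (xs ! i) ^ (if i = k then 1 else 0)) = xs ! k" for xs :: "real list"
    using assms by (simp add: if_distrib[of "\<lambda>n. _ ^ n"] prod.delta cong: if_cong)
  show ?thesis using polynomial_monomial[of p c "\<lambda>i. if i = k then 1 else 0"] unfolding * .
qed

lemma polynomial_add:
  assumes "polynomial_on_Rpow p f" "polynomial_on_Rpow p h"
  shows "polynomial_on_Rpow p (\<lambda>xs. f xs + h xs)"
proof -
  obtain M c where M: "finite M" "\<And>xs. xs \<in> Rpow p \<Longrightarrow> f xs = (\<Sum>a\<in>M. c a * (\<Prod>i<p. (xs ! i) ^ a i))"
    using assms(1) by (auto simp: polynomial_on_Rpow_def)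
  obtain N d where N: "finite N" "\<And>xs. xs \<in> Rpow p \<Longrightarrow> h xs = (\<Sum>a\<in>N. d a * (\<Prod>i<p. (xs ! i) ^ a i))"
    using assms(2) by (auto simp: polynomial_on_Rpow_def)
  let ?c = "\<lambda>a. (if a \<in> M then c a else 0) + (if a \<in> N then d a else 0)"
  have "f xs + h xs = (\<Sum>a\<in>M \<union> N. ?c a * (\<Prod>i<p. (xs ! i) ^ a i))" if xs: "xs \<in> Rpow p" for xs
  proof -
    have "(\<Sum>a\<in>M. c a * (\<Prod>i<p. (xs ! i) ^ a i))
        = (\<Sum>a\<in>M \<union> N. (if a \<in> M then c a else 0) * (\<Prod>i<p. (xs ! i) ^ a i))"
      using M(1) N(1) by (intro sum.mono_neutral_cong_left) auto
    moreover have "(\<Sum>a\<in>N. d a * (\<Prod>i<p. (xs ! i) ^ a i))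
        = (\<Sum>a\<in>M \<union> N. (if a \<in> N then d a else 0) * (\<Prod>i<p. (xs ! i) ^ a i))"
      using M(1) N(1) by (intro sum.mono_neutral_cong_left) auto
    ultimately show ?thesis
      using xs M(2) N(2) by (simp only: distrib_right sum.distrib)
  qed
  with M(1) N(1) show ?thesis unfolding polynomial_on_Rpow_def
    by (intro exI[of _ "M \<union> N"] exI[of _ ?c]) auto
qed

text \<open>The graphs of \<open>*\<close> and \<open>+\<close> as zero sets; all other polynomial terms arise from them by composition.\<close>

lemma polynomial_product_012: "polynomial_on_Rpow 3 (\<lambda>xs. xs ! 0 * xs ! 1 - xs ! 2)"
proof -
  have *: "(\<Prod>i<3. (xs ! i) ^ (if i < 2 then 1 else 0)) = xs ! 0 * xs ! 1" for xs :: "real list"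
    by (simp add: numeral_3_eq_3)
  have "polynomial_on_Rpow 3 (\<lambda>xs. 1 * (xs ! 0 * xs ! 1) + (- 1) * xs ! 2)"
    using polynomial_monomial[of 3 1 "\<lambda>i. if i < 2 then 1 else 0"] unfolding *
    by (intro polynomial_add polynomial_var) auto
  then show ?thesis by simp
qed

lemma polynomial_sum_012: "polynomial_on_Rpow 3 (\<lambda>xs. xs ! 0 + xs ! 1 - xs ! 2)"
proof -
  have "polynomial_on_Rpow 3 (\<lambda>xs. (1 * xs ! 0 + 1 * xs ! 1) + (- 1) * xs ! 2)"
    by (intro polynomial_add polynomial_var) auto
  then show ?thesis by simp
qed

context o_minimal_structure
begin

section \<open>Definability calculus for first-order formulas\<close>

text \<open>Definability of a predicate on infinite assignments \<open>\<rho>\<close> of real values to variables: it depends on finitely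
many variables only, and the tuples satisfying it form a set of the structure. Leaving the number of variables
implicit lets formulas of different arities be combined. Bound variables follow de Bruijn: under a quantifier the
bound variable is \<open>\<rho> 0\<close>, and an outer variable \<open>\<rho> i\<close> becomes \<open>\<rho> (Suc i)\<close>. With this convention the rules
collected as \<open>definability\<close> reduce definability of a formula to that of its atoms by plain resolution.\<close>

definition definable :: "((nat \<Rightarrow> real) \<Rightarrow> bool) \<Rightarrow> bool" where
  "definable P \<longleftrightarrow> (\<exists>p. \<exists>A\<in>S p. \<forall>\<rho>. P \<rho> \<longleftrightarrow> map \<rho> [0..<p] \<in> A)"

text \<open>The graph of the term, with the value stored in variable \<open>0\<close>.\<close>

definition definable_term :: "((nat \<Rightarrow> real) \<Rightarrow> real) \<Rightarrow> bool" where
  "definable_term u \<longleftrightarrow> definable (\<lambda>\<rho>. u (\<lambda>i. \<rho> (Suc i)) = \<rho> 0)"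

lemma definableI: "A \<in> S p \<Longrightarrow> (\<And>\<rho>. P \<rho> \<longleftrightarrow> map \<rho> [0..<p] \<in> A) \<Longrightarrow> definable P"
  unfolding definable_def by blast

lemma definable_bound:
  assumes "definable P"
  shows "\<exists>p. \<forall>q\<ge>p. \<exists>A\<in>S q. \<forall>\<rho>. P \<rho> \<longleftrightarrow> map \<rho> [0..<q] \<in> A"
proof -
  obtain p A where A: "A \<in> S p" "\<And>\<rho>. P \<rho> \<longleftrightarrow> map \<rho> [0..<p] \<in> A"
    using assms unfolding definable_def by blast
  have "\<exists>A\<in>S q. \<forall>\<rho>. P \<rho> \<longleftrightarrow> map \<rho> [0..<q] \<in> A" if "p \<le> q" for q
  proof
    let ?B = "{xs @ zs | xs zs. xs \<in> A \<and> length zs = q - p}"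
    show "?B \<in> S q" using append_Rpow_mem[OF A(1), of "q - p"] that by simp
    have split: "map \<rho> [0..<q] = map \<rho> [0..<p] @ map \<rho> [p..<q]" for \<rho> :: "nat \<Rightarrow> real"
      using that by (metis map_append upt_add_eq_append le0 le_add_diff_inverse add_0)
    show "\<forall>\<rho>. P \<rho> \<longleftrightarrow> map \<rho> [0..<q] \<in> ?B"
    proof (intro allI iffI)
      fix \<rho> :: "nat \<Rightarrow> real"
      assume "P \<rho>"
      then show "map \<rho> [0..<q] \<in> ?B"
        using A(2) split by (intro CollectI exI[of _ "map \<rho> [0..<p]"] exI[of _ "map \<rho> [p..<q]"]) auto
    next
      fix \<rho> :: "nat \<Rightarrow> real"
      assume "map \<rho> [0..<q] \<in> ?B"
      then show "P \<rho>"
        using length_mem[OF A(1)] unfolding A(2) split by (auto simp: append_eq_append_conv)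
    qed
  qed
  then show ?thesis by blast
qed

lemma definable_not [definability]:
  assumes "definable P"
  shows "definable (\<lambda>\<rho>. \<not> P \<rho>)"
proof -
  obtain p A where "A \<in> S p" "\<And>\<rho>. P \<rho> \<longleftrightarrow> map \<rho> [0..<p] \<in> A"
    using assms unfolding definable_def by blast
  then show ?thesis by (intro definableI[OF Diff_mem[OF Rpow_mem]]) (auto simp: Rpow_def)
qed

lemma definable_conj [definability]:
  assumes "definable P" "definable Q"
  shows "definable (\<lambda>\<rho>. P \<rho> \<and> Q \<rho>)"
proof -
  obtain p where p: "\<forall>q\<ge>p. \<exists>A\<in>S q. \<forall>\<rho>. P \<rho> \<longleftrightarrow> map \<rho> [0..<q] \<in> A"
    using definable_bound[OF assms(1)] by blast
  obtain q where q: "\<forall>r\<ge>q. \<exists>A\<in>S r. \<forall>\<rho>. Q \<rho> \<longleftrightarrow> map \<rho> [0..<r] \<in> A"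
    using definable_bound[OF assms(2)] by blast
  obtain A where "A \<in> S (max p q)" "\<And>\<rho>. P \<rho> \<longleftrightarrow> map \<rho> [0..<max p q] \<in> A"
    using p[rule_format, of "max p q"] by auto
  moreover obtain B where "B \<in> S (max p q)" "\<And>\<rho>. Q \<rho> \<longleftrightarrow> map \<rho> [0..<max p q] \<in> B"
    using q[rule_format, of "max p q"] by auto
  ultimately show ?thesis by (intro definableI[OF Int_mem[of A _ B]]) auto
qed

lemma definable_disj [definability]:
  assumes "definable P" "definable Q"
  shows "definable (\<lambda>\<rho>. P \<rho> \<or> Q \<rho>)"
proof -
  have "definable (\<lambda>\<rho>. \<not> (\<not> P \<rho> \<and> \<not> Q \<rho>))" by (intro definable_not definable_conj assms)
  then show ?thesis by simp
qed

lemma definable_imp [definability]: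
  "definable P \<Longrightarrow> definable Q \<Longrightarrow> definable (\<lambda>\<rho>. P \<rho> \<longrightarrow> Q \<rho>)"
  unfolding imp_conv_disj by (intro definable_disj definable_not)

lemma definable_True [definability]: "definable (\<lambda>\<rho>. True)"
  by (rule definableI[OF Rpow_mem[of 0]]) (simp add: Rpow_def)

lemma definable_finite_Ball:
  "finite I \<Longrightarrow> (\<And>i. i \<in> I \<Longrightarrow> definable (P i)) \<Longrightarrow> definable (\<lambda>\<rho>. \<forall>i\<in>I. P i \<rho>)"
proof (induction I rule: finite_induct)
  case empty
  show ?case using definable_True by simp
next
  case (insert i I)
  then have "definable (\<lambda>\<rho>. P i \<rho> \<and> (\<forall>i\<in>I. P i \<rho>))" by (intro definable_conj) simp_all
  then show ?case by simp
qed

lemma definable_finite_all [definability]: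
  "(\<And>i::'i::finite. definable (P i)) \<Longrightarrow> definable (\<lambda>\<rho>. \<forall>i. P i \<rho>)"
  using definable_finite_Ball[of UNIV P] by simp

lemma definable_finite_ex [definability]:
  assumes "\<And>i::'i::finite. definable (P i)"
  shows "definable (\<lambda>\<rho>. \<exists>i. P i \<rho>)"
proof -
  have "definable (\<lambda>\<rho>. \<not> (\<forall>i. \<not> P i \<rho>))" by (intro definable_not definable_finite_all assms)
  then show ?thesis by simp
qed

text \<open>The preimage of \<open>A\<close> under a change of variables is the projection of the set of all \<open>xs @ ys\<close> with \<open>ys \<in> A\<close>
and \<open>ys ! i = xs ! \<sigma> i\<close>. Permuting, duplicating and forgetting coordinates are instances, which frees the
calculus from the fixed coordinate positions in the axioms.\<close>

lemma substitution_mem: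
  assumes A: "A \<in> S p" and \<sigma>: "\<And>i. i < p \<Longrightarrow> \<sigma> i < q"
  shows "{xs \<in> Rpow q. map (\<lambda>i. xs ! \<sigma> i) [0..<p] \<in> A} \<in> S q"
proof -
  let ?C = "{zs @ xs | zs xs. xs \<in> A \<and> length zs = q}"
  let ?E = "\<lambda>i. {zs \<in> Rpow (q + p). 1 * zs ! (q + i) + (- 1) * zs ! \<sigma> i = 0}"
  let ?D = "?C \<inter> (Rpow (q + p) \<inter> (\<Inter>i<p. ?E i))"
  have "?E i \<in> S (q + p)" if "i < p" for i
    using that \<sigma>[OF that] by (intro zero_sets polynomial_add polynomial_var) auto
  then have "Rpow (q + p) \<inter> (\<Inter>i<p. ?E i) \<in> S (q + p)"
    by (intro finite_Inter_mem) auto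
  then have "take q ` ?D \<in> S q"
    by (rule take_mem[OF Int_mem[OF prepend_Rpow_mem[OF A]]])
  moreover have "take q ` ?D = {xs \<in> Rpow q. map (\<lambda>i. xs ! \<sigma> i) [0..<p] \<in> A}"
  proof (intro set_eqI iffI)
    fix xs assume "xs \<in> take q ` ?D"
    then obtain ys where ys: "length xs = q" "ys \<in> A" "xs @ ys \<in> (\<Inter>i<p. ?E i)"
      by auto
    then have "\<forall>i<p. ys ! i = xs ! \<sigma> i"
      using \<sigma> by (auto simp: nth_append)
    then have "map (\<lambda>i. xs ! \<sigma> i) [0..<p] = ys"
      using length_mem[OF A ys(2)] by (intro nth_equalityI) auto
    with ys show "xs \<in> {xs \<in> Rpow q. map (\<lambda>i. xs ! \<sigma> i) [0..<p] \<in> A}" by (simp add: Rpow_def)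
  next
    fix xs assume xs: "xs \<in> {xs \<in> Rpow q. map (\<lambda>i. xs ! \<sigma> i) [0..<p] \<in> A}"
    let ?z = "xs @ map (\<lambda>i. xs ! \<sigma> i) [0..<p]"
    have "?z \<in> ?D" using xs \<sigma> by (auto simp: Rpow_def nth_append)
    moreover have "xs = take q ?z" using xs by (simp add: Rpow_def)
    ultimately show "xs \<in> take q ` ?D" by (rule rev_image_eqI)
  qed
  ultimately show ?thesis by simp
qed

lemma definable_subst:
  assumes "definable P"
  shows "definable (\<lambda>\<rho>. P (\<lambda>i. \<rho> (\<sigma> i)))"
proof -
  obtain p A where A: "A \<in> S p" "\<And>\<rho>. P \<rho> \<longleftrightarrow> map \<rho> [0..<p] \<in> A"
    using assms unfolding definable_def by blast
  define q where "q = Suc (Max (insert 0 (\<sigma> ` {..<p})))"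
  have \<sigma>: "\<sigma> i < q" if "i < p" for i
    unfolding q_def less_Suc_eq_le using that by (intro Max_ge) auto
  show ?thesis
  proof (rule definableI[OF substitution_mem[OF A(1) \<sigma>]])
    fix \<rho> :: "nat \<Rightarrow> real"
    have "map (\<lambda>i. map \<rho> [0..<q] ! \<sigma> i) [0..<p] = map (\<lambda>i. \<rho> (\<sigma> i)) [0..<p]"
      using \<sigma> by simp
    then show "P (\<lambda>i. \<rho> (\<sigma> i)) \<longleftrightarrow>
        map \<rho> [0..<q] \<in> {xs \<in> Rpow q. map (\<lambda>i. xs ! \<sigma> i) [0..<p] \<in> A}"
      unfolding A(2) mem_Collect_eq by (simp only:) (simp add: Rpow_def)
  qed
qed

text \<open>The axioms project along the last coordinate, whereas the bound variable is the first one, so the proof rotates the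
coordinates before projecting.\<close>

lemma definable_ex [definability]:
  assumes "definable (\<lambda>\<rho>. Q (\<lambda>i. \<rho> (Suc i)) (\<rho> 0))"
  shows "definable (\<lambda>\<rho>. \<exists>x::real. Q \<rho> x)"
proof -
  let ?P = "\<lambda>\<rho>. Q (\<lambda>i. \<rho> (Suc i)) (\<rho> 0)"
  obtain p where p: "\<forall>q\<ge>p. \<exists>A\<in>S q. \<forall>\<rho>. ?P \<rho> \<longleftrightarrow> map \<rho> [0..<q] \<in> A"
    using definable_bound[OF assms] by blast
  obtain A where A: "A \<in> S (Suc p)" "\<And>\<rho>. ?P \<rho> \<longleftrightarrow> map \<rho> [0..<Suc p] \<in> A"
    using p[rule_format, of "Suc p"] by auto
  define \<sigma> where "\<sigma> i = (if i = 0 then p else i - 1)" for i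
  let ?B = "{xs \<in> Rpow (Suc p). map (\<lambda>i. xs ! \<sigma> i) [0..<Suc p] \<in> A}"
  have B: "butlast ` ?B \<in> S p"
    by (intro projection substitution_mem A(1)) (auto simp: \<sigma>_def)
  have rotate: "map (\<lambda>i. (map \<rho> [0..<p] @ [x]) ! \<sigma> i) [0..<Suc p] = map (case_nat x \<rho>) [0..<Suc p]"
    for \<rho> x
    by (intro nth_equalityI) (auto simp: \<sigma>_def nth_append simp del: upt_Suc split: nat.split)
  have Q: "Q \<rho> x \<longleftrightarrow> map \<rho> [0..<p] @ [x] \<in> ?B" for \<rho> x
    using A(2)[of "case_nat x \<rho>"] unfolding mem_Collect_eq rotate by (simp add: Rpow_def)
  show ?thesis
  proof (rule definableI[OF B])
    fix \<rho> :: "nat \<Rightarrow> real"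
    show "(\<exists>x. Q \<rho> x) \<longleftrightarrow> map \<rho> [0..<p] \<in> butlast ` ?B"
    proof
      assume "\<exists>x. Q \<rho> x"
      then obtain x where "map \<rho> [0..<p] @ [x] \<in> ?B" unfolding Q by blast
      then have "butlast (map \<rho> [0..<p] @ [x]) \<in> butlast ` ?B" by (rule imageI)
      then show "map \<rho> [0..<p] \<in> butlast ` ?B" unfolding butlast_snoc .
    next
      assume "map \<rho> [0..<p] \<in> butlast ` ?B"
      then obtain xs where xs: "xs \<in> ?B" "map \<rho> [0..<p] = butlast xs" by blast
      have "xs \<noteq> []" using xs(1) by (auto simp: Rpow_def)
      then have "xs = map \<rho> [0..<p] @ [last xs]" using xs(2) by simp
      then have "map \<rho> [0..<p] @ [last xs] \<in> ?B"
        using xs(1) by (rule subst[where P = "\<lambda>x. x \<in> ?B"])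
      then show "\<exists>x. Q \<rho> x" unfolding Q by (rule exI)
    qed
  qed
qed

lemma definable_all [definability]:
  assumes "definable (\<lambda>\<rho>. Q (\<lambda>i. \<rho> (Suc i)) (\<rho> 0))"
  shows "definable (\<lambda>\<rho>. \<forall>x::real. Q \<rho> x)"
proof -
  have "definable (\<lambda>\<rho>. \<not> (\<exists>x. \<not> Q \<rho> x))" by (intro definable_not definable_ex assms)
  then show ?thesis by simp
qed

lemma definable_zero_set:
  "polynomial_on_Rpow p f \<Longrightarrow> (\<And>\<rho>. P \<rho> \<longleftrightarrow> f (map \<rho> [0..<p]) = 0) \<Longrightarrow> definable P"
  by (rule definableI[OF zero_sets]) (auto simp: Rpow_def)

text \<open>Here \<open>Q \<rho> (u \<rho>)\<close> is expressed as \<open>\<exists>x. u \<rho> = x \<and> Q \<rho> x\<close>.\<close>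

lemma definable_let:
  assumes "definable_term u" "definable (\<lambda>\<rho>. Q (\<lambda>i. \<rho> (Suc i)) (\<rho> 0))"
  shows "definable (\<lambda>\<rho>. Q \<rho> (u \<rho>))"
proof -
  have "definable (\<lambda>\<rho>. \<exists>x. u \<rho> = x \<and> Q \<rho> x)"
    using assms unfolding definable_term_def by (intro definable_ex definable_conj)
  then show ?thesis by simp
qed

lemma definable_term_subst:
  assumes "definable_term u"
  shows "definable_term (\<lambda>\<rho>. u (\<lambda>i. \<rho> (\<sigma> i)))"
  using definable_subst[OF assms[unfolded definable_term_def], of "\<lambda>i. case i of 0 \<Rightarrow> 0 | Suc j \<Rightarrow> Suc (\<sigma> j)"]
  by (simp add: definable_term_def)

lemma definable_let2:
  assumes "definable_term u" "definable_term v" "definable (\<lambda>\<rho>. R (\<rho> 0) (\<rho> 1))"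
  shows "definable (\<lambda>\<rho>. R (u \<rho>) (v \<rho>))"
proof (rule definable_let[where Q = "\<lambda>\<rho> x. R x (v \<rho>)", OF assms(1)])
  have "definable (\<lambda>\<rho>. R (\<rho> 1) (\<rho> 0))" using definable_subst[OF assms(3), of "\<lambda>i. 1 - i"] by simp
  then have "definable (\<lambda>\<rho>. R (\<rho> (Suc 0)) (\<rho> 0))" by simp
  then show "definable (\<lambda>\<rho>. R (\<rho> 0) (v (\<lambda>i. \<rho> (Suc i))))"
    by (rule definable_let[where Q = "\<lambda>\<rho> y. R (\<rho> 0) y", OF definable_term_subst[OF assms(2)]])
qed

lemma definable_term_app2:
  assumes "definable_term u" "definable_term v" "definable (\<lambda>\<rho>. F (\<rho> 0) (\<rho> 1) = \<rho> 2)"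
  shows "definable_term (\<lambda>\<rho>. F (u \<rho>) (v \<rho>))"
  unfolding definable_term_def
proof (rule definable_let[where Q = "\<lambda>\<rho> x. F x (v (\<lambda>i. \<rho> (Suc i))) = \<rho> 0", OF definable_term_subst[OF assms(1)]])
  have "definable (\<lambda>\<rho>. F (\<rho> (Suc 0)) (\<rho> 0) = \<rho> (Suc (Suc 0)))"
    using definable_subst[OF assms(3), of "\<lambda>i. if i = 2 then 2 else 1 - i"] by (simp add: numeral_2_eq_2)
  then show "definable (\<lambda>\<rho>. F (\<rho> 0) (v (\<lambda>i. \<rho> (Suc (Suc i)))) = \<rho> (Suc 0))"
    by (rule definable_let[where Q = "\<lambda>\<rho> y. F (\<rho> 0) y = \<rho> (Suc 0)", OF definable_term_subst[OF assms(2)]])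
qed

lemma definable_var_eq: "definable (\<lambda>\<rho>. \<rho> j = \<rho> k)"
proof -
  have "polynomial_on_Rpow (Suc (max j k)) (\<lambda>xs. 1 * xs ! j + (- 1) * xs ! k)"
    by (intro polynomial_add polynomial_var) auto
  then show ?thesis by (rule definable_zero_set) (simp del: upt_Suc)
qed

lemma definable_term_var [definability]: "definable_term (\<lambda>\<rho>. \<rho> k)"
  unfolding definable_term_def by (rule definable_var_eq)

lemma definable_term_const [definability]: "definable_term (\<lambda>\<rho>. c)"
proof -
  have "polynomial_on_Rpow 1 (\<lambda>xs. c + (- 1) * xs ! 0)"
    by (intro polynomial_add polynomial_var polynomial_const) auto
  then show ?thesis unfolding definable_term_def by (rule definable_zero_set) auto
qed

lemma definable_term_add [definability]:
  "definable_term u \<Longrightarrow> definable_term v \<Longrightarrow> definable_term (\<lambda>\<rho>. u \<rho> + v \<rho>)"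
  by (rule definable_term_app2[where F = "(+)", OF _ _ definable_zero_set[OF polynomial_sum_012]])
    (simp_all add: eval_nat_numeral)

lemma definable_term_mult [definability]:
  "definable_term u \<Longrightarrow> definable_term v \<Longrightarrow> definable_term (\<lambda>\<rho>. u \<rho> * v \<rho>)"
  by (rule definable_term_app2[where F = "(*)", OF _ _ definable_zero_set[OF polynomial_product_012]])
    (simp_all add: eval_nat_numeral)

lemma definable_term_minus [definability]:
  assumes "definable_term u"
  shows "definable_term (\<lambda>\<rho>. - u \<rho>)"
proof -
  have "definable_term (\<lambda>\<rho>. - 1 * u \<rho>)" by (intro definable_term_mult definable_term_const assms)
  then show ?thesis by simp
qed

lemma definable_term_diff [definability]:
  assumes "definable_term u" "definable_term v"
  shows "definable_term (\<lambda>\<rho>. u \<rho> - v \<rho>)"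
proof -
  have "definable_term (\<lambda>\<rho>. u \<rho> + - v \<rho>)" by (intro definable_term_add definable_term_minus assms)
  then show ?thesis by simp
qed

lemma definable_term_sum [definability]:
  "finite I \<Longrightarrow> (\<And>i. i \<in> I \<Longrightarrow> definable_term (u i)) \<Longrightarrow>
    definable_term (\<lambda>\<rho>. \<Sum>i\<in>I. u i \<rho>)"
proof (induction I rule: finite_induct)
  case empty
  show ?case using definable_term_const[of 0] by simp
next
  case (insert i I)
  then have "definable_term (\<lambda>\<rho>. u i \<rho> + (\<Sum>i\<in>I. u i \<rho>))" by (intro definable_term_add) simp_all
  with insert show ?case by simp
qed

lemma definable_eq [definability]:
  "definable_term u \<Longrightarrow> definable_term v \<Longrightarrow> definable (\<lambda>\<rho>. u \<rho> = v \<rho>)"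
  by (rule definable_let2[where R = "(=)", OF _ _ definable_var_eq])

text \<open>The order is definable because positive reals are the nonzero squares.\<close>

lemma definable_less [definability]:
  assumes "definable_term u" "definable_term v"
  shows "definable (\<lambda>\<rho>. u \<rho> < v \<rho>)"
proof (rule definable_let2[where R = "(<)", OF assms])
  have "(x < y) \<longleftrightarrow> (\<exists>z. z \<noteq> 0 \<and> x + z * z = y)" for x y :: real
  proof
    assume "x < y"
    then show "\<exists>z. z \<noteq> 0 \<and> x + z * z = y"
      by (intro exI[of _ "sqrt (y - x)"]) auto
  next
    assume "\<exists>z. z \<noteq> 0 \<and> x + z * z = y"
    then show "x < y" by (metis less_add_same_cancel1 not_real_square_gt_zero)
  qed
  moreover have "definable (\<lambda>\<rho>. \<exists>z. z \<noteq> 0 \<and> \<rho> 0 + z * z = \<rho> 1)"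
    by (intro definable_ex definable_conj definable_not definable_eq definable_term_add definable_term_mult
        definable_term_var definable_term_const)
  ultimately show "definable (\<lambda>\<rho>. \<rho> 0 < \<rho> 1)" by simp
qed

lemma definable_le [definability]:
  "definable_term u \<Longrightarrow> definable_term v \<Longrightarrow> definable (\<lambda>\<rho>. u \<rho> \<le> v \<rho>)"
  using definable_not[OF definable_less, of v u] by (simp add: not_less)

lemma definable_term_if [definability]:
  assumes "definable P" "definable_term u" "definable_term v"
  shows "definable_term (\<lambda>\<rho>. if P \<rho> then u \<rho> else v \<rho>)"
proof -
  have "definable (\<lambda>\<rho>. (P (\<lambda>i. \<rho> (Suc i)) \<longrightarrow> u (\<lambda>i. \<rho> (Suc i)) = \<rho> 0) \<and>
      (\<not> P (\<lambda>i. \<rho> (Suc i)) \<longrightarrow> v (\<lambda>i. \<rho> (Suc i)) = \<rho> 0))"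
    by (intro definability definable_subst[OF assms(1)] assms(2,3)[unfolded definable_term_def])
  then show ?thesis unfolding definable_term_def by (rule back_subst[of definable]) auto
qed

lemma definable_term_abs [definability]: "definable_term u \<Longrightarrow> definable_term (\<lambda>\<rho>. \<bar>u \<rho>\<bar>)"
  unfolding abs_if by (intro definable_term_if definable_less definable_term_minus definable_term_const)

lemma definable_term_app:
  assumes "definable_term (\<lambda>\<rho>. f (\<rho> 0))" "definable_term u"
  shows "definable_term (\<lambda>\<rho>. f (u \<rho>))"
proof -
  have "definable (\<lambda>\<rho>. f (\<rho> 0) = \<rho> 1)"
    by (intro definable_eq definable_term_var assms)
  then show ?thesis
    unfolding definable_term_def
    by (rule definable_let2[where R = "\<lambda>x y. f x = y", OF definable_term_subst[OF assms(2)] definable_term_var])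
qed


text \<open>Only finitely many variables of \<open>P\<close> matter, so the terms can be substituted one after the other. The renaming
\<open>\<sigma>\<close> in the induction keeps track of the shifts caused by the intermediate bound variables.\<close>

lemma definable_simultaneous_subst:
  assumes "definable P" "\<And>i. definable_term (v i)"
  shows "definable (\<lambda>\<rho>. P (\<lambda>i. v i \<rho>))"
proof -
  have step: "definable (\<lambda>\<rho>. P (\<lambda>i. if i < k then v i \<rho> else \<rho> (\<sigma> i)))"
    if "\<And>i. definable_term (v i)" for k v \<sigma>
    using that
  proof (induction k arbitrary: v \<sigma>)
    case 0
    show ?case using definable_subst[OF assms(1)] by simp
  next
    case (Suc k)
    let ?Q = "\<lambda>\<rho> x. P (\<lambda>i. if i < k then v i \<rho> else if i = k then x else \<rho> (\<sigma> i))"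
    have "definable (\<lambda>\<rho>. P (\<lambda>i. if i < k then v i (\<lambda>i. \<rho> (Suc i))
        else \<rho> (if i = k then 0 else Suc (\<sigma> i))))"
      by (rule Suc.IH) (rule definable_term_subst[OF Suc.prems])
    also have "(\<lambda>\<rho>. P (\<lambda>i. if i < k then v i (\<lambda>i. \<rho> (Suc i))
        else \<rho> (if i = k then 0 else Suc (\<sigma> i)))) = (\<lambda>\<rho>. ?Q (\<lambda>i. \<rho> (Suc i)) (\<rho> 0))"
      by (intro ext arg_cong[of _ _ P]) simp
    finally have "definable (\<lambda>\<rho>. ?Q \<rho> (v k \<rho>))"
      by (rule definable_let[OF Suc.prems, where Q = ?Q])
    also have "(\<lambda>\<rho>. ?Q \<rho> (v k \<rho>)) = (\<lambda>\<rho>. P (\<lambda>i. if i < Suc k then v i \<rho> else \<rho> (\<sigma> i)))"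
      by (intro ext arg_cong[of _ _ P]) (auto simp: less_Suc_eq)
    finally show ?case .
  qed
  obtain p A where A: "\<And>\<rho>. P \<rho> \<longleftrightarrow> map \<rho> [0..<p] \<in> A"
    using assms(1) unfolding definable_def by blast
  have "P (\<lambda>i. if i < p then v i \<rho> else \<rho> i) \<longleftrightarrow> P (\<lambda>i. v i \<rho>)" for \<rho>
    unfolding A by (intro arg_cong[of _ _ "\<lambda>xs. xs \<in> A"]) simp
  with step[where v = v and k = p and \<sigma> = "\<lambda>i. i"] assms(2) show ?thesis by simp
qed

text \<open>All real constants are definable, so parameters may be frozen.\<close>

lemma definable_fix_parameters:
  assumes "definable (\<lambda>\<rho>. Q (\<lambda>i. \<rho> (Suc i)) (\<rho> 0))"
  shows "definable (\<lambda>\<rho>. Q \<rho>\<^sub>0 (\<rho> 0))"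
proof -
  have "definable_term (\<lambda>\<rho>. case i of 0 \<Rightarrow> \<rho> 0 | Suc j \<Rightarrow> \<rho>\<^sub>0 j)" for i
    by (cases i) (simp_all add: definable_term_var definable_term_const)
  then show ?thesis
    using definable_simultaneous_subst[OF assms, of "\<lambda>i \<rho>. case i of 0 \<Rightarrow> \<rho> 0 | Suc j \<Rightarrow> \<rho>\<^sub>0 j"] by simp
qed

text \<open>Connects functions whose graph is given through an enumeration of the coordinates with the calculus. The conclusion
no longer mentions the enumeration, and it is the form in which definability of the constraints is used below.\<close>

lemma definable_term_fun:
  fixes g :: "real ^ 'n::finite \<Rightarrow> real"
  assumes e: "bij_betw e {..<CARD('n)} UNIV" and g: "definable_fun S e g"
    and u: "\<And>k. definable_term (u k)"
  shows "definable_term (\<lambda>\<rho>. g (\<chi> k. u k \<rho>))"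
proof -
  let ?n = "CARD('n)"
  define d where "d = the_inv_into {..<?n} e"
  have d: "d k < ?n" "e (d k) = k" for k
    using the_inv_into_into[of e "{..<?n}" k] f_the_inv_into_f_bij_betw[OF e] e
    by (auto simp: d_def bij_betw_def)
  have de: "d (e i) = i" if "i < ?n" for i
    using the_inv_into_f_f[of e] e that by (auto simp: d_def bij_betw_def)
  have "definable (\<lambda>\<rho>. g (\<chi> k. \<rho> (d k)) = \<rho> ?n)"
  proof (rule definableI)
    show "{coords e x @ [g x] | x. True} \<in> S (Suc ?n)"
      using g by (simp add: definable_fun_def)
    fix \<rho> :: "nat \<Rightarrow> real"
    have eq: "map \<rho> [0..<?n] = coords e x \<longleftrightarrow> (\<chi> k. \<rho> (d k)) = x" for x
    proof
      assume "map \<rho> [0..<?n] = coords e x"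
      then have "\<rho> i = x $ e i" if "i < ?n" for i
        using that by (simp add: coords_def)
      then show "(\<chi> k. \<rho> (d k)) = x" using d by (simp add: vec_eq_iff)
    qed (auto simp: coords_def de)
    have "map \<rho> [0..<Suc ?n] \<in> {coords e x @ [g x] | x. True}
        \<longleftrightarrow> (\<exists>x. map \<rho> [0..<?n] = coords e x \<and> \<rho> ?n = g x)" by simp
    then show "g (\<chi> k. \<rho> (d k)) = \<rho> ?n \<longleftrightarrow> map \<rho> [0..<Suc ?n] \<in> {coords e x @ [g x] | x. True}"
      unfolding eq by auto
  qed
  moreover have "definable_term (\<lambda>\<rho>. if i < ?n then u (e i) (\<lambda>i. \<rho> (Suc i)) else \<rho> 0)" for i
    by (cases "i < ?n") (simp_all add: definable_term_var definable_term_subst[OF u])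
  ultimately have "definable (\<lambda>\<rho>. g (\<chi> k. u (e (d k)) (\<lambda>i. \<rho> (Suc i))) = \<rho> 0)"
    using definable_simultaneous_subst[of "\<lambda>\<rho>. g (\<chi> k. \<rho> (d k)) = \<rho> ?n"
      "\<lambda>i \<rho>. if i < ?n then u (e i) (\<lambda>i. \<rho> (Suc i)) else \<rho> 0"] d(1) by simp
  then show ?thesis by (simp add: definable_term_def d(2))
qed

lemma definable_eventually_at_right [definability]:
  assumes "definable_term u" "definable (\<lambda>\<rho>. Q (\<lambda>i. \<rho> (Suc i)) (\<rho> 0))"
  shows "definable (\<lambda>\<rho>. \<forall>\<^sub>F s in at_right (u \<rho>). Q \<rho> s)"
proof -
  have "definable (\<lambda>\<rho>. Q (\<lambda>i. \<rho> (Suc (Suc i))) (\<rho> 0))"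
    using definable_subst[OF assms(2), of "\<lambda>i. case i of 0 \<Rightarrow> 0 | Suc j \<Rightarrow> Suc (Suc j)"] by simp
  then have "definable (\<lambda>\<rho>. \<exists>b. u \<rho> < b \<and> (\<forall>y. u \<rho> < y \<longrightarrow> y < b \<longrightarrow> Q \<rho> y))"
    by (intro definable_ex definable_all definable_conj definable_imp definable_less definable_term_var definable_term_subst[OF assms(1)])
  then show ?thesis by (simp add: eventually_at_right_field)
qed

lemma definable_eventually_at_left [definability]:
  assumes "definable_term u" "definable (\<lambda>\<rho>. Q (\<lambda>i. \<rho> (Suc i)) (\<rho> 0))"
  shows "definable (\<lambda>\<rho>. \<forall>\<^sub>F s in at_left (u \<rho>). Q \<rho> s)"
proof -
  have "definable (\<lambda>\<rho>. Q (\<lambda>i. \<rho> (Suc (Suc i))) (\<rho> 0))"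
    using definable_subst[OF assms(2), of "\<lambda>i. case i of 0 \<Rightarrow> 0 | Suc j \<Rightarrow> Suc (Suc j)"] by simp
  then have "definable (\<lambda>\<rho>. \<exists>b. b < u \<rho> \<and> (\<forall>y. b < y \<longrightarrow> y < u \<rho> \<longrightarrow> Q \<rho> y))"
    by (intro definable_ex definable_all definable_conj definable_imp definable_less definable_term_var definable_term_subst[OF assms(1)])
  then show ?thesis by (simp add: eventually_at_left_field)
qed

end

section \<open>One-sided dichotomy for definable subsets of the line\<close>

lemma is_interval_one_sided:
  fixes I :: "real set"
  assumes "is_interval I"
  shows "(\<forall>\<^sub>F s in at_right t. s \<in> I) \<or> (\<forall>\<^sub>F s in at_right t. s \<notin> I)"
    and "(\<forall>\<^sub>F s in at_left t. s \<in> I) \<or> (\<forall>\<^sub>F s in at_left t. s \<notin> I)"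
proof -
  have I: "x \<in> I" if "a \<in> I" "b \<in> I" "a < x" "x < b" for a b x
    using assms that by (meson is_interval_1 less_imp_le)
  show "(\<forall>\<^sub>F s in at_right t. s \<in> I) \<or> (\<forall>\<^sub>F s in at_right t. s \<notin> I)"
  proof (cases "\<forall>b>t. \<exists>y\<in>I. t < y \<and> y < b")
    case True
    moreover obtain b where "b \<in> I" "t < b" using True gt_ex[of t] by blast
    ultimately show ?thesis unfolding eventually_at_right_field using I by blast
  next
    case False
    then show ?thesis unfolding eventually_at_right_field by blast
  qed
  show "(\<forall>\<^sub>F s in at_left t. s \<in> I) \<or> (\<forall>\<^sub>F s in at_left t. s \<notin> I)"
  proof (cases "\<forall>b<t. \<exists>y\<in>I. b < y \<and> y < t")
    case True
    moreover obtain b where "b \<in> I" "b < t" using True lt_ex[of t] by blast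
    ultimately show ?thesis unfolding eventually_at_left_field using I by blast
  next
    case False
    then show ?thesis unfolding eventually_at_left_field by blast
  qed
qed

lemma eventually_dichotomy_Union:
  assumes "finite \<I>" "\<And>I. I \<in> \<I> \<Longrightarrow> (\<forall>\<^sub>F s in F. s \<in> I) \<or> (\<forall>\<^sub>F s in F. s \<notin> I)"
  shows "(\<forall>\<^sub>F s in F. s \<in> \<Union>\<I>) \<or> (\<forall>\<^sub>F s in F. s \<notin> \<Union>\<I>)"
proof (cases "\<exists>I\<in>\<I>. \<forall>\<^sub>F s in F. s \<in> I")
  case True
  then obtain I where I: "I \<in> \<I>" "\<forall>\<^sub>F s in F. s \<in> I" by blast
  have "\<forall>\<^sub>F s in F. s \<in> \<Union>\<I>" using I(2) by (rule eventually_mono) (use I(1) in blast)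
  then show ?thesis ..
next
  case False
  then have "\<forall>\<^sub>F s in F. \<forall>I\<in>\<I>. s \<notin> I"
    using assms by (intro eventually_ball_finite) blast+
  then show ?thesis by simp
qed

context o_minimal_structure
begin

text \<open>A finite union of points and intervals cannot oscillate when \<open>t\<close> is approached from one side. All later facts about
definable functions of one variable rest on this.\<close>

lemma
  assumes "definable (\<lambda>\<rho>. P (\<rho> 0))"
  shows at_right_dichotomy: "(\<forall>\<^sub>F s in at_right t. P s) \<or> (\<forall>\<^sub>F s in at_right t. \<not> P s)"
    and at_left_dichotomy: "(\<forall>\<^sub>F s in at_left t. P s) \<or> (\<forall>\<^sub>F s in at_left t. \<not> P s)"
proof -
  obtain p A where A: "A \<in> S p" "\<And>\<rho>. P (\<rho> 0) \<longleftrightarrow> map \<rho> [0..<p] \<in> A"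
    using assms unfolding definable_def by blast
  have "{xs \<in> Rpow 1. map (\<lambda>i. xs ! 0) [0..<p] \<in> A} \<in> S 1"
    by (rule substitution_mem[OF A(1)]) simp
  also have "{xs \<in> Rpow 1. map (\<lambda>i. xs ! 0) [0..<p] \<in> A} = (\<lambda>t. [t]) ` {t. P t}"
  proof -
    have "xs \<in> {xs \<in> Rpow 1. map (\<lambda>i. xs ! 0) [0..<p] \<in> A} \<longleftrightarrow> (\<exists>t. xs = [t] \<and> P t)" for xs
      using A(2)[of "\<lambda>_. xs ! 0"] by (cases xs) (auto simp: Rpow_def)
    then show ?thesis by blast
  qed
  finally have "\<exists>\<I> :: real set set. finite \<I> \<and> (\<forall>I\<in>\<I>. (\<exists>a. I = {a}) \<or> is_interval I) \<and>
      (\<lambda>t. [t]) ` {t. P t} = (\<lambda>t. [t]) ` \<Union>\<I>"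
    by (rule dimension_one[THEN iffD1])
  then obtain \<I> :: "real set set" where \<I>: "finite \<I>"
    "\<forall>I\<in>\<I>. (\<exists>a. I = {a}) \<or> is_interval I" "(\<lambda>t. [t]) ` {t. P t} = (\<lambda>t. [t]) ` \<Union>\<I>"
    by blast
  have "inj (\<lambda>t::real. [t])" by (simp add: inj_on_def)
  then have "{t. P t} = \<Union>\<I>" using \<I>(3) by (simp only: inj_image_eq_iff)
  then have P: "P t \<longleftrightarrow> t \<in> \<Union>\<I>" for t by blast
  have "is_interval {a}" for a :: real
    unfolding is_interval_1 by auto
  then have int: "is_interval I" if "I \<in> \<I>" for I
    using bspec[OF \<I>(2) that] by (elim disjE exE) simp_all
  show "(\<forall>\<^sub>F s in at_right t. P s) \<or> (\<forall>\<^sub>F s in at_right t. \<not> P s)"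
    unfolding P by (rule eventually_dichotomy_Union[OF \<I>(1) is_interval_one_sided(1)[OF int]])
  show "(\<forall>\<^sub>F s in at_left t. P s) \<or> (\<forall>\<^sub>F s in at_left t. \<not> P s)"
    unfolding P by (rule eventually_dichotomy_Union[OF \<I>(1) is_interval_one_sided(2)[OF int]])
qed

end

section \<open>Definable functions of one variable near zero\<close>

text \<open>A supremum argument. The hypothesis on the left only excludes that \<open>f\<close> jumps down when \<open>t\<close> is reached from the
left; the slack \<open>\<epsilon>\<close> makes the lemma applicable to a monotone function minus a linear one.\<close>

lemma monotone_from_one_sided:
  fixes f :: "real \<Rightarrow> real"
  assumes right: "\<And>t. a < t \<Longrightarrow> t < b \<Longrightarrow> \<forall>\<^sub>F s in at_right t. f t \<le> f s"
    and left: "\<And>t \<epsilon>. a < t \<Longrightarrow> t < b \<Longrightarrow> \<epsilon> > 0 \<Longrightarrow> \<forall>\<^sub>F s in at_left t. f s \<le> f t + \<epsilon>"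
    and tu: "a < t" "t \<le> u" "u < b"
  shows "f t \<le> f u"
proof -
  define A where "A = {s \<in> {t..u}. \<forall>r\<in>{t..s}. f t \<le> f r}"
  define \<sigma> where "\<sigma> = Sup A"
  have bdd: "bdd_above A" by (rule bdd_aboveI[of _ u]) (auto simp: A_def)
  have tA: "t \<in> A" using tu by (auto simp: A_def)
  then have t\<sigma>: "t \<le> \<sigma>" unfolding \<sigma>_def using bdd by (rule cSup_upper)
  have \<sigma>u: "\<sigma> \<le> u" unfolding \<sigma>_def using tA by (intro cSup_least) (auto simp: A_def)
  have below: "f t \<le> f r" if r: "t \<le> r" "r < \<sigma>" for r
  proof -
    obtain s where "s \<in> A" "r < s"
      using r(2) tA less_cSup_iff[OF _ bdd] unfolding \<sigma>_def by blast
    then show ?thesis using r(1) by (auto simp: A_def)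
  qed
  have at: "f t \<le> f \<sigma>"
  proof (cases "t = \<sigma>")
    case False
    show ?thesis
    proof (rule field_le_epsilon)
      fix \<epsilon> :: real assume "\<epsilon> > 0"
      then have "\<forall>\<^sub>F s in at_left \<sigma>. f s \<le> f \<sigma> + \<epsilon>"
        using t\<sigma> \<sigma>u tu by (intro left) auto
      moreover have "\<forall>\<^sub>F s in at_left \<sigma>. s \<in> {t<..<\<sigma>}"
        using False t\<sigma> by (intro eventually_at_leftI[of t]) auto
      ultimately have "\<forall>\<^sub>F s in at_left \<sigma>. f s \<le> f \<sigma> + \<epsilon> \<and> s \<in> {t<..<\<sigma>}"
        by (rule eventually_conj)
      then obtain s where "f s \<le> f \<sigma> + \<epsilon>" "s \<in> {t<..<\<sigma>}"
        using eventually_happens'[OF trivial_limit_at_left_real] by blast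
      then show "f t \<le> f \<sigma> + \<epsilon>" using below[of s] by auto
    qed
  qed simp
  have "\<sigma> = u"
  proof (rule ccontr)
    assume "\<sigma> \<noteq> u"
    then have "\<sigma> < u" using \<sigma>u by simp
    obtain c where c: "\<sigma> < c" "\<And>s. \<sigma> < s \<Longrightarrow> s < c \<Longrightarrow> f \<sigma> \<le> f s"
      using right[of \<sigma>] t\<sigma> \<sigma>u tu unfolding eventually_at_right_field by auto
    obtain s where s: "\<sigma> < s" "s < min u c" using dense[of \<sigma> "min u c"] \<open>\<sigma> < u\<close> c(1) by auto
    have "f t \<le> f r" if "t \<le> r" "r \<le> s" for r
    proof -
      consider "r < \<sigma>" | "r = \<sigma>" | "\<sigma> < r" by linarith
      then show ?thesis
        using below[of r] at c(2)[of r] that s by cases auto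
    qed
    then have "s \<in> A" using s t\<sigma> by (auto simp: A_def)
    then have "s \<le> \<sigma>" unfolding \<sigma>_def using bdd by (rule cSup_upper)
    with s show False by simp
  qed
  with at show ?thesis by simp
qed

text \<open>A strict local minimum is the only strict minimum of \<open>f\<close> on some interval with rational end points.\<close>

lemma countable_strict_local_minima:
  fixes f :: "real \<Rightarrow> real"
  shows "countable {t. (\<forall>\<^sub>F s in at_left t. f t < f s) \<and> (\<forall>\<^sub>F s in at_right t. f t < f s)}"
    (is "countable ?M")
proof -
  let ?N = "\<lambda>p q. {t \<in> {p<..<q}. \<forall>s\<in>{p<..<q}. s \<noteq> t \<longrightarrow> f t < f s}"
  have cover: "?M \<subseteq> (\<Union>p\<in>\<rat>. \<Union>q\<in>\<rat>. ?N p q)"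
  proof
    fix t assume "t \<in> ?M"
    then obtain a b where ab: "a < t" "\<And>s. a < s \<Longrightarrow> s < t \<Longrightarrow> f t < f s"
      "t < b" "\<And>s. t < s \<Longrightarrow> s < b \<Longrightarrow> f t < f s"
      unfolding eventually_at_left_field eventually_at_right_field by auto
    obtain p where p: "p \<in> \<rat>" "a < p" "p < t" using Rats_dense_in_real[OF ab(1)] by auto
    obtain q where q: "q \<in> \<rat>" "t < q" "q < b" using Rats_dense_in_real[OF ab(3)] by auto
    have "f t < f s" if "p < s" "s < q" "s \<noteq> t" for s
      using ab(2)[of s] ab(4)[of s] that p q by (cases "s < t") auto
    then have "t \<in> ?N p q" using p q by simp
    then show "t \<in> (\<Union>p\<in>\<rat>. \<Union>q\<in>\<rat>. ?N p q)" using p(1) q(1) by blast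
  qed
  have single: "countable (?N p q)" for p q
  proof -
    have unique: "s = t" if st: "s \<in> ?N p q" "t \<in> ?N p q" for s t
    proof (rule ccontr)
      assume "s \<noteq> t"
      then have "f s < f t" "f t < f s" using st by auto
      then show False by simp
    qed
    show ?thesis
    proof (cases "?N p q = {}")
      case False
      then obtain t where t: "t \<in> ?N p q" unfolding ex_in_conv[symmetric] ..
      have "?N p q \<subseteq> {t}" by (rule subsetI) (use unique[OF _ t] in simp)
      then show ?thesis by (rule countable_subset) simp
    qed (simp only: countable_empty)
  qed
  have "countable (\<Union>p\<in>\<rat>. \<Union>q\<in>\<rat>. ?N p q)"
    by (rule countable_UN[OF countable_rat countable_UN[OF countable_rat single]])
  then show ?thesis by (rule countable_subset[rotated]) (rule cover)
qed

context o_minimal_structure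
begin

text \<open>To the left of a small \<open>t\<close>, either \<open>f\<close> exceeds \<open>f t\<close> or it does not, and by the dichotomy in \<open>t\<close> the same
case occurs for all small \<open>t\<close>. In the first case every small \<open>t\<close> would be a strict local minimum, which is
impossible for uncountably many points; in the second one the local increase propagates.\<close>

lemma increasing_near_zero:
  fixes f :: "real \<Rightarrow> real"
  assumes f: "definable_term (\<lambda>\<rho>. f (\<rho> 0))"
    and right: "\<forall>\<^sub>F t in at_right 0. \<forall>\<^sub>F s in at_right t. f t < f s"
  shows "\<exists>d>0. \<forall>s t. 0 < s \<longrightarrow> s \<le> t \<longrightarrow> t < d \<longrightarrow> f s \<le> f t"
proof -
  let ?min = "\<lambda>t. \<forall>\<^sub>F s in at_left t. f t < f s"
  have "definable (\<lambda>\<rho>. ?min (\<rho> 0))"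
    by (intro definability definable_term_app[OF f])
  note dichotomy = at_right_dichotomy[OF this, of 0]
  have "\<not> (\<forall>\<^sub>F t in at_right 0. ?min t)"
  proof
    assume "\<forall>\<^sub>F t in at_right 0. ?min t"
    with right have "\<forall>\<^sub>F t in at_right 0. ?min t \<and> (\<forall>\<^sub>F s in at_right t. f t < f s)"
      by (rule eventually_conj[rotated])
    then obtain d where "0 < d" "\<forall>t>0. t < d \<longrightarrow> ?min t \<and> (\<forall>\<^sub>F s in at_right t. f t < f s)"
      unfolding eventually_at_right_field[of _ 0] by blast
    then have "{0<..<d} \<subseteq> {t. ?min t \<and> (\<forall>\<^sub>F s in at_right t. f t < f s)}" by auto
    then have "countable {0<..<d}"
      by (rule countable_subset[OF _ countable_strict_local_minima])
    then show False using uncountable_open_interval[of 0 d] \<open>0 < d\<close> by simp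
  qed
  then have "\<forall>\<^sub>F t in at_right 0. \<not> ?min t"
    using dichotomy by blast
  with right have "\<forall>\<^sub>F t in at_right 0. \<not> ?min t \<and> (\<forall>\<^sub>F s in at_right t. f t < f s)"
    by (rule eventually_conj[rotated])
  then obtain d where d: "0 < d" "\<forall>t>0. t < d \<longrightarrow> \<not> ?min t \<and> (\<forall>\<^sub>F s in at_right t. f t < f s)"
    unfolding eventually_at_right_field[of _ 0] by blast
  have "f s \<le> f t" if "0 < s" "s \<le> t" "t < d" for s t
  proof (rule monotone_from_one_sided[OF _ _ that])
    fix t :: real assume t: "0 < t" "t < d"
    then show "\<forall>\<^sub>F s in at_right t. f t \<le> f s"
      using d(2) by (auto elim!: eventually_mono)
    fix \<epsilon> :: real assume "\<epsilon> > 0"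
    have "\<not> ?min t" using d(2) t by blast
    moreover have "definable (\<lambda>\<rho>. f t < f (\<rho> 0))"
      by (intro definable_less definable_term_app[OF f] definable_term_var definable_term_const)
    ultimately have "\<forall>\<^sub>F s in at_left t. \<not> f t < f s"
      using at_left_dichotomy[of "\<lambda>s. f t < f s" t] by blast
    then show "\<forall>\<^sub>F s in at_left t. f s \<le> f t + \<epsilon>"
      by (rule eventually_mono) (use \<open>\<epsilon> > 0\<close> in linarith)
  qed
  with d(1) show ?thesis by blast
qed

text \<open>By the preceding lemma \<open>f\<close> is monotone near \<open>0\<close>; subtracting \<open>C * t\<close> preserves the local increase, so \<open>f\<close>
grows at rate at least \<open>C\<close> on a fixed interval, for every \<open>C\<close>.\<close>

lemma not_infinite_right_slope:
  fixes f :: "real \<Rightarrow> real"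
  assumes f: "definable_term (\<lambda>\<rho>. f (\<rho> 0))"
    and slope: "\<forall>\<^sub>F t in at_right 0. \<forall>C. \<forall>\<^sub>F s in at_right t. C * (s - t) < f s - f t"
  shows False
proof -
  have "\<forall>\<^sub>F t in at_right 0. \<forall>\<^sub>F s in at_right t. f t < f s"
    using slope
  proof (rule eventually_mono)
    fix t assume "\<forall>C. \<forall>\<^sub>F s in at_right t. C * (s - t) < f s - f t"
    from this[rule_format, of 0] show "\<forall>\<^sub>F s in at_right t. f t < f s" by simp
  qed
  from increasing_near_zero[OF f this]
  obtain d where d: "0 < d" "\<And>s t. 0 < s \<Longrightarrow> s \<le> t \<Longrightarrow> t < d \<Longrightarrow> f s \<le> f t" by blast
  obtain d' where d': "0 < d'"
    "\<And>t C. 0 < t \<Longrightarrow> t < d' \<Longrightarrow> \<forall>\<^sub>F s in at_right t. C * (s - t) < f s - f t"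
    using slope unfolding eventually_at_right_field[of _ 0] by blast
  define b where "b = min d d'"
  have b: "b > 0" "b \<le> d" "b \<le> d'" using d d' by (auto simp: b_def)
  have growth: "C * (u - t) \<le> f u - f t" if "0 < t" "t \<le> u" "u < b" "C > 0" for t u C
  proof -
    have "f t - C * t \<le> f u - C * u"
    proof (rule monotone_from_one_sided[where f = "\<lambda>t. f t - C * t", OF _ _ that(1-3)])
      fix t :: real assume t: "0 < t" "t < b"
      have "\<forall>\<^sub>F s in at_right t. C * (s - t) < f s - f t" using t b by (intro d') auto
      then show "\<forall>\<^sub>F s in at_right t. f t - C * t \<le> f s - C * s"
        by (rule eventually_mono) (simp add: algebra_simps)
      fix \<epsilon> :: real assume "\<epsilon> > 0"
      then have "max 0 (t - \<epsilon> / C) < t" using t that(4) by simp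
      then have "\<forall>\<^sub>F s in at_left t. s \<in> {max 0 (t - \<epsilon> / C)<..<t}"
        by (intro eventually_at_leftI[of "max 0 (t - \<epsilon> / C)"]) auto
      then show "\<forall>\<^sub>F s in at_left t. f s - C * s \<le> f t - C * t + \<epsilon>"
      proof (rule eventually_mono)
        fix s assume s: "s \<in> {max 0 (t - \<epsilon> / C)<..<t}"
        then have "C * t - \<epsilon> \<le> C * s" using that(4) by (simp add: field_simps)
        moreover have "f s \<le> f t" using s t b by (intro d(2)) auto
        ultimately show "f s - C * s \<le> f t - C * t + \<epsilon>" by simp
      qed
    qed
    then show ?thesis by (simp add: algebra_simps)
  qed
  \<comment> \<open>the slope \<open>4 * (D + 1) / b\<close> on an interval of length \<open>b / 4\<close> exceeds the actual increase \<open>D\<close>\<close>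
  define D where "D = f (b/2) - f (b/4)"
  have "D \<ge> 0" using d(2)[of "b/4" "b/2"] b by (simp add: D_def)
  have "(4 * (D + 1) / b) * (b/2 - b/4) \<le> D"
    unfolding D_def[symmetric] using growth[of "b/4" "b/2" "4 * (D + 1) / b"] b \<open>D \<ge> 0\<close>
    by (simp add: D_def)
  moreover have "(4 * (D + 1) / b) * (b/2 - b/4) = D + 1" using b by (simp add: field_simps)
  ultimately show False by simp
qed

text \<open>If the property failed for arbitrarily small \<open>t\<close>, then by the dichotomy it would fail for all small \<open>t\<close>; there
the right difference quotients would tend to infinity in absolute value, with a sign that is the same for all
small \<open>t\<close>. This contradicts the preceding lemma, applied to \<open>f\<close> or to \<open>- f\<close>.\<close>

lemma right_lipschitz_near_zero:
  fixes f :: "real \<Rightarrow> real"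
  assumes f: "definable_term (\<lambda>\<rho>. f (\<rho> 0))"
  shows "\<forall>\<^sub>F t in at_right 0. \<exists>C. \<forall>\<^sub>F s in at_right t. \<bar>f s - f t\<bar> \<le> C * (s - t)"
    (is "\<forall>\<^sub>F t in at_right 0. ?L t")
proof (rule ccontr)
  assume not: "\<not> (\<forall>\<^sub>F t in at_right 0. ?L t)"
  have "definable (\<lambda>\<rho>. ?L (\<rho> 0))"
    by (intro definability definable_term_app[OF f])
  then have "\<forall>\<^sub>F t in at_right 0. \<not> ?L t"
    using at_right_dichotomy[of ?L 0] not by blast
  moreover have "\<forall>C. \<forall>\<^sub>F s in at_right t. C * (s - t) < \<bar>f s - f t\<bar>" if "\<not> ?L t" for t
  proof
    fix C
    have "definable (\<lambda>\<rho>. \<bar>f (\<rho> 0) - f t\<bar> \<le> C * (\<rho> 0 - t))"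
      by (intro definability definable_term_app[OF f])
    from at_right_dichotomy[OF this, of t] show "\<forall>\<^sub>F s in at_right t. C * (s - t) < \<bar>f s - f t\<bar>"
      using that by (auto simp: not_le)
  qed
  ultimately have steep: "\<forall>\<^sub>F t in at_right 0. \<forall>C. \<forall>\<^sub>F s in at_right t. C * (s - t) < \<bar>f s - f t\<bar>"
    by (auto elim: eventually_mono)
  let ?up = "\<lambda>t. \<forall>\<^sub>F s in at_right t. f t < f s"
  have "definable (\<lambda>\<rho>. ?up (\<rho> 0))"
    by (intro definability definable_term_app[OF f])
  from at_right_dichotomy[OF this, of 0] show False
  proof
    assume "\<forall>\<^sub>F t in at_right 0. ?up t"
    with steep have "\<forall>\<^sub>F t in at_right 0. \<forall>C. \<forall>\<^sub>F s in at_right t. C * (s - t) < f s - f t"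
    proof eventually_elim
      case (elim t)
      show ?case
      proof
        fix C
        show "\<forall>\<^sub>F s in at_right t. C * (s - t) < f s - f t"
          using elim(1)[rule_format, of C] elim(2) by eventually_elim auto
      qed
    qed
    then show False by (rule not_infinite_right_slope[OF f])
  next
    assume "\<forall>\<^sub>F t in at_right 0. \<not> ?up t"
    with steep have "\<forall>\<^sub>F t in at_right 0. \<forall>C. \<forall>\<^sub>F s in at_right t. C * (s - t) < - f s - (- f t)"
    proof eventually_elim
      case (elim t)
      have "definable (\<lambda>\<rho>. f t < f (\<rho> 0))" by (intro definability definable_term_app[OF f])
      then have down: "\<forall>\<^sub>F s in at_right t. \<not> f t < f s"
        using at_right_dichotomy[of "\<lambda>s. f t < f s" t] elim(2) by blast
      show ?case
      proof
        fix C
        show "\<forall>\<^sub>F s in at_right t. C * (s - t) < - f s - (- f t)"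
          using elim(1)[rule_format, of C] down by eventually_elim auto
      qed
    qed
    then show False by (rule not_infinite_right_slope[OF definable_term_minus[OF f]])
  qed
qed

text \<open>Otherwise \<open>f\<close> would be nonincreasing near \<open>0\<close>, which is incompatible with being positive and tending to \<open>0\<close>.\<close>

lemma right_nondecreasing_near_zero:
  fixes f :: "real \<Rightarrow> real"
  assumes f: "definable_term (\<lambda>\<rho>. f (\<rho> 0))"
    and small: "\<forall>\<^sub>F t in at_right 0. 0 < f t \<and> f t \<le> t"
  shows "\<forall>\<^sub>F t in at_right 0. \<forall>\<^sub>F s in at_right t. f t \<le> f s"
    (is "\<forall>\<^sub>F t in at_right 0. ?I t")
proof (rule ccontr)
  assume not: "\<not> (\<forall>\<^sub>F t in at_right 0. ?I t)"
  have "definable (\<lambda>\<rho>. ?I (\<rho> 0))"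
    by (intro definability definable_term_app[OF f])
  then have "\<forall>\<^sub>F t in at_right 0. \<not> ?I t"
    using at_right_dichotomy[of ?I 0] not by blast
  then have "\<forall>\<^sub>F t in at_right 0. \<forall>\<^sub>F s in at_right t. - f t < - f s"
  proof (rule eventually_mono)
    fix t assume "\<not> ?I t"
    moreover have "definable (\<lambda>\<rho>. f t \<le> f (\<rho> 0))" by (intro definability definable_term_app[OF f])
    ultimately have "\<forall>\<^sub>F s in at_right t. \<not> f t \<le> f s"
      using at_right_dichotomy[of "\<lambda>s. f t \<le> f s" t] by blast
    then show "\<forall>\<^sub>F s in at_right t. - f t < - f s" by (rule eventually_mono) simp
  qed
  from increasing_near_zero[OF definable_term_minus[OF f] this]
  obtain d where d: "0 < d" "\<And>s t. 0 < s \<Longrightarrow> s \<le> t \<Longrightarrow> t < d \<Longrightarrow> f t \<le> f s" by auto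
  obtain d' where d': "0 < d'" "\<And>t. 0 < t \<Longrightarrow> t < d' \<Longrightarrow> 0 < f t \<and> f t \<le> t"
    using small unfolding eventually_at_right_field by auto
  define t where "t = min d d' / 2"
  have t: "0 < t" "t < d" "t < d'" using d(1) d'(1) by (auto simp: t_def)
  define s where "s = min t (f t) / 2"
  have s: "0 < s" "s \<le> t" "s < d'" "s < f t" using t d'(2)[of t] by (auto simp: s_def)
  show False using d(2)[of s t] d'(2)[of s] s t by auto
qed


section \<open>Definable choice and quantification over vectors\<close>

lemma definable_inst:
  assumes "definable (\<lambda>\<rho>. Q (\<lambda>i. \<rho> (Suc i)) (\<rho> 0))" "definable_term u"
  shows "definable (\<lambda>\<rho>. Q (\<lambda>i. \<rho> (\<sigma> i)) (u \<rho>))"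
proof -
  have "definable_term (\<lambda>\<rho>. case i of 0 \<Rightarrow> u \<rho> | Suc j \<Rightarrow> \<rho> (\<sigma> j))" for i
    by (cases i) (simp_all add: definable_term_var assms(2))
  then show ?thesis
    using definable_simultaneous_subst[OF assms(1), of "\<lambda>i \<rho>. case i of 0 \<Rightarrow> u \<rho> | Suc j \<Rightarrow> \<rho> (\<sigma> j)"]
    by simp
qed

lemma definable_term_Inf:
  assumes Q: "definable (\<lambda>\<rho>. Q (\<lambda>i. \<rho> (Suc i)) (\<rho> 0))"
    and nonempty: "\<And>\<rho>. \<exists>r. Q \<rho> r" and nonneg: "\<And>\<rho> r. Q \<rho> r \<Longrightarrow> 0 \<le> r"
  shows "definable_term (\<lambda>\<rho>. Inf {r. Q \<rho> r})"
proof -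
  have "Inf {r. Q \<rho> r} = a \<longleftrightarrow>
      (\<forall>r. Q \<rho> r \<longrightarrow> a \<le> r) \<and> (\<forall>b. (\<forall>r. Q \<rho> r \<longrightarrow> b \<le> r) \<longrightarrow> b \<le> a)"
      (is "_ = a \<longleftrightarrow> ?glb a") for \<rho> a
  proof -
    have "bdd_below {r. Q \<rho> r}" using nonneg by (intro bdd_belowI[of _ 0]) auto
    then have glb: "?glb (Inf {r. Q \<rho> r})"
      using nonempty by (auto intro!: cInf_lower cInf_greatest)
    show ?thesis
    proof
      assume "?glb a"
      with glb have "a \<le> Inf {r. Q \<rho> r}" "Inf {r. Q \<rho> r} \<le> a" by blast+
      then show "Inf {r. Q \<rho> r} = a" by simp
    qed (use glb in simp)
  qed
  moreover have "definable (\<lambda>\<rho>. (\<forall>r. Q (\<lambda>i. \<rho> (Suc i)) r \<longrightarrow> \<rho> 0 \<le> r) \<and>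
      (\<forall>b. (\<forall>r. Q (\<lambda>i. \<rho> (Suc i)) r \<longrightarrow> b \<le> r) \<longrightarrow> b \<le> \<rho> 0))"
    by (intro definable_conj definable_all definable_imp definable_le definable_inst[OF Q] definable_term_var)
  ultimately show ?thesis by (simp add: definable_term_def)
qed

text \<open>A nonempty definable set \<open>W\<close> of nonnegative reals has a definable element: its infimum \<open>a\<close> if that belongs to
\<open>W\<close>; otherwise \<open>W\<close> contains an interval to the right of \<open>a\<close> by the dichotomy, and the midpoint between \<open>a\<close> and
the first failure of \<open>W\<close> beyond \<open>a\<close> is taken. The general case follows by choosing an absolute value first and
then a sign.\<close>

lemma definable_choice_real:
  fixes Q :: "(nat \<Rightarrow> real) \<Rightarrow> real \<Rightarrow> bool"
  assumes Q: "definable (\<lambda>\<rho>. Q (\<lambda>i. \<rho> (Suc i)) (\<rho> 0))"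
  shows "\<exists>u. definable_term u \<and> (\<forall>\<rho>. (\<exists>r. Q \<rho> r) \<longrightarrow> Q \<rho> (u \<rho>))"
proof -
  \<comment> \<open>the second disjunct only makes \<open>W \<rho>\<close> nonempty in every case\<close>
  define W where "W \<rho> r \<longleftrightarrow> 0 \<le> r \<and> (Q \<rho> r \<or> Q \<rho> (- r)) \<or> (\<forall>s. \<not> Q \<rho> s) \<and> r = 0" for \<rho> r
  have W: "definable (\<lambda>\<rho>. W (\<lambda>i. \<rho> (Suc i)) (\<rho> 0))"
    unfolding W_def by (intro definability definable_inst[OF Q])
  have W_ne: "\<exists>r. W \<rho> r" for \<rho>
  proof (cases "\<exists>s. Q \<rho> s")
    case True
    then obtain s where "Q \<rho> s" by blast
    then have "W \<rho> \<bar>s\<bar>" unfolding W_def by (cases "0 \<le> s") auto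
    then show ?thesis by blast
  qed (auto simp: W_def)
  have W_nonneg: "0 \<le> r" if "W \<rho> r" for \<rho> r using that by (auto simp: W_def)
  define a where "a \<rho> = Inf {r. W \<rho> r}" for \<rho>
  have a: "definable_term a" unfolding a_def[abs_def] by (rule definable_term_Inf[OF W W_ne W_nonneg])
  have a_le: "a \<rho> \<le> r" if "W \<rho> r" for \<rho> r
    unfolding a_def using that W_nonneg by (intro cInf_lower bdd_belowI[of _ 0]) auto
  have a_nonneg: "0 \<le> a \<rho>" for \<rho>
    unfolding a_def using W_ne W_nonneg by (intro cInf_greatest) auto
  \<comment> \<open>the bound \<open>a \<rho> + 1\<close> makes this set nonempty even if \<open>W\<close> never fails\<close>
  define F where "F \<rho> s \<longleftrightarrow> a \<rho> < s \<and> (\<not> W \<rho> s \<or> a \<rho> + 1 \<le> s)" for \<rho> s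
  have F: "definable (\<lambda>\<rho>. F (\<lambda>i. \<rho> (Suc i)) (\<rho> 0))"
    unfolding F_def by (intro definability W definable_term_subst[OF a])
  have F_ne: "\<exists>s. F \<rho> s" for \<rho> by (rule exI[of _ "a \<rho> + 1"]) (simp add: F_def)
  have F_nonneg: "0 \<le> s" if "F \<rho> s" for \<rho> s
    using that a_nonneg[of \<rho>] unfolding F_def by linarith
  define b where "b \<rho> = Inf {s. F \<rho> s}" for \<rho>
  have b: "definable_term b" unfolding b_def[abs_def] by (rule definable_term_Inf[OF F F_ne F_nonneg])
  have b_le: "b \<rho> \<le> s" if "F \<rho> s" for \<rho> s
    unfolding b_def using that F_nonneg by (intro cInf_lower bdd_belowI[of _ 0]) auto
  define c where "c \<rho> = (if W \<rho> (a \<rho>) then a \<rho> else 1 / 2 * (a \<rho> + b \<rho>))" for \<rho>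
  have c: "definable_term c" unfolding c_def[abs_def]
    by (intro definable_term_if definable_let[OF a W] definable_term_mult definable_term_const definable_term_add
      a b)
  have Wc: "W \<rho> (c \<rho>)" for \<rho>
  proof (cases "W \<rho> (a \<rho>)")
    case False
    have "\<not> (\<forall>\<^sub>F s in at_right (a \<rho>). \<not> W \<rho> s)"
    proof
      assume "\<forall>\<^sub>F s in at_right (a \<rho>). \<not> W \<rho> s"
      then obtain d where d: "a \<rho> < d" "\<And>s. a \<rho> < s \<Longrightarrow> s < d \<Longrightarrow> \<not> W \<rho> s"
        unfolding eventually_at_right_field by auto
      then obtain r where r: "W \<rho> r" "r < d"
        using cInf_lessD[of "{r. W \<rho> r}" d] W_ne unfolding a_def by blast
      then have "a \<rho> < r" using a_le[OF r(1)] False by (cases "a \<rho> = r") auto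
      with d(2) r show False by blast
    qed
    then have "\<forall>\<^sub>F s in at_right (a \<rho>). W \<rho> s"
      using at_right_dichotomy[OF definable_fix_parameters[OF W, of \<rho>]] by blast
    then obtain d where d: "a \<rho> < d" "\<And>s. a \<rho> < s \<Longrightarrow> s < d \<Longrightarrow> W \<rho> s"
      unfolding eventually_at_right_field by auto
    have "min d (a \<rho> + 1) \<le> b \<rho>"
      unfolding b_def
    proof (rule cInf_greatest)
      fix s assume "s \<in> {s. F \<rho> s}"
      then show "min d (a \<rho> + 1) \<le> s" using d(2)[of s] by (cases "s < d") (auto simp: F_def)
    qed (use F_ne in auto)
    then have "a \<rho> < b \<rho>" using d(1) by auto
    then have "a \<rho> < c \<rho>" "c \<rho> < b \<rho>" using False by (simp_all add: c_def)
    then show ?thesis using b_le[of \<rho> "c \<rho>"] by (auto simp: F_def)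
  qed (simp add: c_def)
  define u where "u \<rho> = (if Q \<rho> (c \<rho>) then c \<rho> else - c \<rho>)" for \<rho>
  have "definable_term u" unfolding u_def[abs_def]
    by (intro definable_term_if definable_term_minus c definable_let[OF c Q])
  moreover have "Q \<rho> (u \<rho>)" if "\<exists>r. Q \<rho> r" for \<rho>
    using Wc[of \<rho>] that unfolding W_def u_def by auto
  ultimately show ?thesis by blast
qed

text \<open>Definability of a predicate with a vector argument means: it is definable whenever definable terms are
inserted for the coordinates, after any renaming \<open>\<sigma>\<close> of the remaining variables. This avoids choosing an
order on the coordinates, and the renaming absorbs the shifts under further quantifiers. The proof quantifies
the coordinates one by one.\<close>

lemma definable_ex_vec:
  fixes Q :: "(nat \<Rightarrow> real) \<Rightarrow> real ^ 'n::finite \<Rightarrow> bool"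
  assumes Q: "\<And>\<sigma> w. (\<And>k. definable_term (w k)) \<Longrightarrow> definable (\<lambda>\<rho>. Q (\<lambda>i. \<rho> (\<sigma> i)) (\<chi> k. w k \<rho>))"
  shows "definable (\<lambda>\<rho>. \<exists>x. Q \<rho> x)"
proof -
  have "definable (\<lambda>\<rho>. \<exists>x. (\<forall>k. k \<notin> K \<longrightarrow> x $ k = w k \<rho>) \<and> Q (\<lambda>i. \<rho> (\<sigma> i)) x)"
    if "finite K" "\<And>k. definable_term (w k)" for K :: "'n set" and w \<sigma>
    using that
  proof (induction K arbitrary: w \<sigma> rule: finite_induct)
    case empty
    have "(\<exists>x. (\<forall>k. k \<notin> {} \<longrightarrow> x $ k = w k \<rho>) \<and> Q (\<lambda>i. \<rho> (\<sigma> i)) x) \<longleftrightarrow>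
        Q (\<lambda>i. \<rho> (\<sigma> i)) (\<chi> k. w k \<rho>)" for \<rho>
    proof -
      have "(\<forall>k. x $ k = w k \<rho>) \<longleftrightarrow> x = (\<chi> k. w k \<rho>)" for x by (simp add: vec_eq_iff)
      then show ?thesis by simp
    qed
    with Q[OF empty] show ?case by simp
  next
    case (insert j K)
    let ?w = "\<lambda>k \<rho>. if k = j then \<rho> 0 else w k (\<lambda>i. \<rho> (Suc i))"
    have "definable (\<lambda>\<rho>. \<exists>x. (\<forall>k. k \<notin> K \<longrightarrow> x $ k = ?w k \<rho>) \<and> Q (\<lambda>i. \<rho> (Suc (\<sigma> i))) x)"
    proof (rule insert.IH)
      show "definable_term (?w k)" for k
        by (cases "k = j") (simp_all add: definable_term_var definable_term_subst[OF insert.prems])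
    qed
    then have "definable (\<lambda>\<rho>. \<exists>r x. (\<forall>k. k \<notin> K \<longrightarrow> x $ k = (if k = j then r else w k \<rho>)) \<and>
        Q (\<lambda>i. \<rho> (\<sigma> i)) x)"
      by (rule definable_ex)
    also have "(\<lambda>\<rho>. \<exists>r x. (\<forall>k. k \<notin> K \<longrightarrow> x $ k = (if k = j then r else w k \<rho>)) \<and>
        Q (\<lambda>i. \<rho> (\<sigma> i)) x)
        = (\<lambda>\<rho>. \<exists>x. (\<forall>k. k \<notin> insert j K \<longrightarrow> x $ k = w k \<rho>) \<and> Q (\<lambda>i. \<rho> (\<sigma> i)) x)"
    proof (intro ext iffI)
      fix \<rho> :: "nat \<Rightarrow> real"
      assume "\<exists>r x. (\<forall>k. k \<notin> K \<longrightarrow> x $ k = (if k = j then r else w k \<rho>)) \<and> Q (\<lambda>i. \<rho> (\<sigma> i)) x"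
      then obtain r x where "\<forall>k. k \<notin> K \<longrightarrow> x $ k = (if k = j then r else w k \<rho>)" "Q (\<lambda>i. \<rho> (\<sigma> i)) x"
        by blast
      then show "\<exists>x. (\<forall>k. k \<notin> insert j K \<longrightarrow> x $ k = w k \<rho>) \<and> Q (\<lambda>i. \<rho> (\<sigma> i)) x"
        by (intro exI[of _ x]) simp
    next
      fix \<rho> :: "nat \<Rightarrow> real"
      assume "\<exists>x. (\<forall>k. k \<notin> insert j K \<longrightarrow> x $ k = w k \<rho>) \<and> Q (\<lambda>i. \<rho> (\<sigma> i)) x"
      then obtain x where "\<forall>k. k \<notin> insert j K \<longrightarrow> x $ k = w k \<rho>" "Q (\<lambda>i. \<rho> (\<sigma> i)) x" by blast
      then show "\<exists>r x. (\<forall>k. k \<notin> K \<longrightarrow> x $ k = (if k = j then r else w k \<rho>)) \<and> Q (\<lambda>i. \<rho> (\<sigma> i)) x"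
        by (intro exI[of _ "x $ j"] exI[of _ x]) simp
    qed
    finally show ?case .
  qed
  from this[of UNIV "\<lambda>_ _. 0" "\<lambda>i. i"] show ?thesis by (simp add: definable_term_const)
qed

lemma definable_all_vec:
  fixes Q :: "(nat \<Rightarrow> real) \<Rightarrow> real ^ 'n::finite \<Rightarrow> bool"
  assumes Q: "\<And>\<sigma> w. (\<And>k. definable_term (w k)) \<Longrightarrow> definable (\<lambda>\<rho>. Q (\<lambda>i. \<rho> (\<sigma> i)) (\<chi> k. w k \<rho>))"
  shows "definable (\<lambda>\<rho>. \<forall>x. Q \<rho> x)"
proof -
  have "definable (\<lambda>\<rho>. \<not> (\<exists>x. \<not> Q \<rho> x))" by (intro definable_not definable_ex_vec Q)
  then show ?thesis by simp
qed

text \<open>The coordinates are chosen one after the other, each in dependence on the previous ones.\<close>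

lemma definable_choice_vec:
  fixes Q :: "(nat \<Rightarrow> real) \<Rightarrow> real ^ 'n::finite \<Rightarrow> bool"
  assumes Q: "\<And>\<sigma> w. (\<And>k. definable_term (w k)) \<Longrightarrow> definable (\<lambda>\<rho>. Q (\<lambda>i. \<rho> (\<sigma> i)) (\<chi> k. w k \<rho>))"
  shows "\<exists>u. (\<forall>k. definable_term (u k)) \<and> (\<forall>\<rho>. (\<exists>x. Q \<rho> x) \<longrightarrow> Q \<rho> (\<chi> k. u k \<rho>))"
proof -
  have "\<exists>u. (\<forall>k. definable_term (u k)) \<and> (\<forall>\<rho>. (\<exists>x. Q \<rho> x) \<longrightarrow> (\<exists>x. (\<forall>k\<in>K. x $ k = u k \<rho>) \<and> Q \<rho> x))"
    if "finite K" for K :: "'n set"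
    using that
  proof (induction K rule: finite_induct)
    case empty
    show ?case by (intro exI[of _ "\<lambda>_ _. 0"]) (simp add: definable_term_const)
  next
    case (insert j K)
    then obtain u where u: "\<And>k. definable_term (u k)"
      "\<And>\<rho>. \<exists>x. Q \<rho> x \<Longrightarrow> \<exists>x. (\<forall>k\<in>K. x $ k = u k \<rho>) \<and> Q \<rho> x" by blast
    let ?Q = "\<lambda>\<rho> r. \<exists>x. x $ j = r \<and> (\<forall>k\<in>K. x $ k = u k \<rho>) \<and> Q \<rho> x"
    have "definable (\<lambda>\<rho>. ?Q (\<lambda>i. \<rho> (Suc i)) (\<rho> 0))"
    proof (rule definable_ex_vec)
      fix \<sigma> :: "nat \<Rightarrow> nat" and w :: "'n \<Rightarrow> (nat \<Rightarrow> real) \<Rightarrow> real"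
      assume w: "\<And>k. definable_term (w k)"
      show "definable (\<lambda>\<rho>. (\<chi> k. w k \<rho>) $ j = \<rho> (\<sigma> 0) \<and>
          (\<forall>k\<in>K. (\<chi> k. w k \<rho>) $ k = u k (\<lambda>i. \<rho> (\<sigma> (Suc i)))) \<and>
          Q (\<lambda>i. \<rho> (\<sigma> (Suc i))) (\<chi> k. w k \<rho>))"
        unfolding vec_lambda_beta
        by (intro definable_conj definable_eq definable_finite_Ball[OF \<open>finite K\<close>] Q w
            definable_term_var definable_term_subst[OF u(1)])
    qed
    then obtain v where v: "definable_term v" "\<And>\<rho>. \<exists>r. ?Q \<rho> r \<Longrightarrow> ?Q \<rho> (v \<rho>)"
      using definable_choice_real[of ?Q] by blast
    let ?u = "\<lambda>k. if k = j then v else u k"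
    have "definable_term (?u k)" for k using u(1) v(1) by simp
    moreover have "\<exists>x. (\<forall>k\<in>insert j K. x $ k = ?u k \<rho>) \<and> Q \<rho> x" if "\<exists>x. Q \<rho> x" for \<rho>
    proof -
      have "\<exists>r. ?Q \<rho> r" using u(2)[OF that] by blast
      then obtain x where "x $ j = v \<rho>" "\<forall>k\<in>K. x $ k = u k \<rho>" "Q \<rho> x" using v(2) by blast
      then show ?thesis using \<open>j \<notin> K\<close> by (intro exI[of _ x]) auto
    qed
    ultimately show ?case by (intro exI[of _ ?u]) blast
  qed
  from this[of UNIV] obtain u where u: "\<And>k. definable_term (u k)"
    "\<And>\<rho>. \<exists>x. Q \<rho> x \<Longrightarrow> \<exists>x. (\<forall>k. x $ k = u k \<rho>) \<and> Q \<rho> x" by auto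
  have "Q \<rho> (\<chi> k. u k \<rho>)" if ex: "\<exists>x. Q \<rho> x" for \<rho>
  proof -
    obtain x where x: "\<forall>k. x $ k = u k \<rho>" "Q \<rho> x" using u(2)[OF ex] by blast
    then have "x = (\<chi> k. u k \<rho>)" by (simp add: vec_eq_iff)
    with x(2) show ?thesis by simp
  qed
  with u(1) show ?thesis by blast
qed

end

section \<open>Critical values of nonnegative combinations\<close>

text \<open>Vanishing of the derivative, in a form that is visibly first-order: the sum norm involves only polynomial operations
and absolute values.\<close>

definition flat_at :: "(real ^ 'n::finite \<Rightarrow> real) \<Rightarrow> real ^ 'n \<Rightarrow> bool" where
  "flat_at \<phi> x \<longleftrightarrow> (\<forall>\<epsilon>>0. \<exists>\<eta>>0. \<forall>y. (\<Sum>k\<in>UNIV. \<bar>y $ k - x $ k\<bar>) < \<eta> \<longrightarrow>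
     \<bar>\<phi> y - \<phi> x\<bar> \<le> \<epsilon> * (\<Sum>k\<in>UNIV. \<bar>y $ k - x $ k\<bar>))"

lemma flat_at_if_zero_derivative:
  assumes "(\<phi> has_derivative (\<lambda>_. 0)) (at x)"
  shows "flat_at \<phi> x"
  unfolding flat_at_def
proof (intro allI impI)
  fix \<epsilon> :: real assume "\<epsilon> > 0"
  then obtain \<eta> where \<eta>: "\<eta> > 0" "\<And>y. norm (y - x) < \<eta> \<Longrightarrow> \<bar>\<phi> y - \<phi> x\<bar> \<le> \<epsilon> * norm (y - x)"
    using assms unfolding has_derivative_at_alt by force
  have norm: "norm (y - x) \<le> (\<Sum>k\<in>UNIV. \<bar>y $ k - x $ k\<bar>)" for y
    using norm_le_l1_cart[of "y - x"] by simp
  have "\<bar>\<phi> y - \<phi> x\<bar> \<le> \<epsilon> * (\<Sum>k\<in>UNIV. \<bar>y $ k - x $ k\<bar>)"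
    if "(\<Sum>k\<in>UNIV. \<bar>y $ k - x $ k\<bar>) < \<eta>" for y
  proof -
    have "\<bar>\<phi> y - \<phi> x\<bar> \<le> \<epsilon> * norm (y - x)" using norm[of y] that by (intro \<eta>(2)) simp
    also have "\<dots> \<le> \<epsilon> * (\<Sum>k\<in>UNIV. \<bar>y $ k - x $ k\<bar>)"
      using norm[of y] \<open>\<epsilon> > 0\<close> by (intro mult_left_mono) auto
    finally show ?thesis .
  qed
  with \<eta>(1) show "\<exists>\<eta>>0. \<forall>y. (\<Sum>k\<in>UNIV. \<bar>y $ k - x $ k\<bar>) < \<eta> \<longrightarrow>
     \<bar>\<phi> y - \<phi> x\<bar> \<le> \<epsilon> * (\<Sum>k\<in>UNIV. \<bar>y $ k - x $ k\<bar>)" by blast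
qed

text \<open>The witnesses are a Fritz John point and its multipliers; constraints with multiplier zero may take any value.\<close>

definition critical_values_in :: "('m::finite \<Rightarrow> real ^ 'n::finite \<Rightarrow> real) \<Rightarrow> real set \<Rightarrow> bool" where
  "critical_values_in g V \<longleftrightarrow> (\<exists>x. \<exists>l :: real ^ 'm. (\<forall>i. 0 \<le> l $ i) \<and> (\<exists>i. 0 < l $ i) \<and>
     flat_at (\<lambda>y. \<Sum>i\<in>UNIV. l $ i * g i y) x \<and> (\<forall>i. 0 < l $ i \<longrightarrow> g i x \<in> V))"

lemma critical_values_in_minus:
  assumes "critical_values_in g V"
  shows "critical_values_in (\<lambda>i x. - g i x) (uminus ` V)"
proof -
  obtain x l where l: "\<forall>i. 0 \<le> l $ i" "\<exists>i. 0 < l $ i"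
    "flat_at (\<lambda>y. \<Sum>i\<in>UNIV. l $ i * g i y) x" "\<forall>i. 0 < l $ i \<longrightarrow> g i x \<in> V"
    using assms unfolding critical_values_in_def by blast
  have "flat_at (\<lambda>y. \<Sum>i\<in>UNIV. l $ i * - g i y) x"
    using l(3) by (simp add: flat_at_def sum_negf abs_minus_commute)
  then show ?thesis
    unfolding critical_values_in_def using l by (intro exI[of _ x] exI[of _ l]) simp
qed

context o_minimal_structure
begin

text \<open>The function may depend on the assignment: below it is a combination of the constraints with variable
  coefficients.\<close>

lemma definable_flat_at:
  fixes \<Phi> :: "(nat \<Rightarrow> real) \<Rightarrow> real ^ 'n::finite \<Rightarrow> real"
  assumes \<Phi>: "\<And>\<sigma> w. (\<And>k. definable_term (w k)) \<Longrightarrow> definable_term (\<lambda>\<rho>. \<Phi> (\<lambda>i. \<rho> (\<sigma> i)) (\<chi> k. w k \<rho>))"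
    and x: "\<And>k. definable_term (x k)"
  shows "definable (\<lambda>\<rho>. flat_at (\<Phi> \<rho>) (\<chi> k. x k \<rho>))"
  unfolding flat_at_def
proof (intro definable_all definable_imp definable_less definable_ex definable_conj definable_term_var
    definable_term_const definable_all_vec)
  fix \<sigma> :: "nat \<Rightarrow> nat" and w :: "'n \<Rightarrow> (nat \<Rightarrow> real) \<Rightarrow> real"
  assume w: "\<And>k. definable_term (w k)"
  note terms = definable_term_sum finite definable_term_abs definable_term_diff definable_term_mult
    w definable_term_var
    definable_term_subst[OF x] \<Phi>
  show "definable_term (\<lambda>\<rho>. \<Sum>k\<in>UNIV. \<bar>(\<chi> k. w k \<rho>) $ k -
      (\<chi> k. x k (\<lambda>i. \<rho> (\<sigma> (Suc (Suc i))))) $ k\<bar>)"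
    unfolding vec_lambda_beta by (intro terms)
  show "definable (\<lambda>\<rho>. \<bar>\<Phi> (\<lambda>i. \<rho> (\<sigma> (Suc (Suc i)))) (\<chi> k. w k \<rho>) -
      \<Phi> (\<lambda>i. \<rho> (\<sigma> (Suc (Suc i)))) (\<chi> k. x k (\<lambda>i. \<rho> (\<sigma> (Suc (Suc i)))))\<bar>
      \<le> \<rho> (\<sigma> (Suc 0)) * (\<Sum>k\<in>UNIV. \<bar>(\<chi> k. w k \<rho>) $ k - (\<chi> k. x k (\<lambda>i. \<rho> (\<sigma> (Suc (Suc i))))) $ k\<bar>))"
    unfolding vec_lambda_beta by (intro definable_le terms)
qed

text \<open>The Sard-type core of the theorem. The critical points are arranged along a definable curve on which the largest
constraint value with a positive multiplier equals the parameter \<open>t\<close>. Moving along this curve the combination grows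
linearly in \<open>t\<close>, against the vanishing of its derivative. Only the points are
chosen definably in \<open>t\<close>, since the multipliers of a single point of the curve produce the contradiction.\<close>

lemma no_small_positive_critical_values:
  fixes g :: "'m::finite \<Rightarrow> real ^ 'n::finite \<Rightarrow> real"
  assumes g: "\<And>i w. (\<And>k. definable_term (w k)) \<Longrightarrow> definable_term (\<lambda>\<rho>. g i (\<chi> k. w k \<rho>))"
  shows "\<exists>\<epsilon>>0. \<not> critical_values_in g {0<..<\<epsilon>}"
proof (rule ccontr)
  assume "\<not> ?thesis"
  then have small: "critical_values_in g {0<..<\<epsilon>}" if "\<epsilon> > 0" for \<epsilon> using that by blast
  define R where "R t x \<longleftrightarrow> (\<exists>l :: real ^ 'm. (\<forall>i. 0 \<le> l $ i) \<and>
      flat_at (\<lambda>y. \<Sum>i\<in>UNIV. l $ i * g i y) x \<and> (\<exists>i. 0 < l $ i \<and> g i x = t) \<and>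
      (\<forall>i. 0 < l $ i \<longrightarrow> 0 < g i x \<and> g i x \<le> t))" for t x
  have R: "definable (\<lambda>\<rho>. R (u \<rho>) (\<chi> k. w k \<rho>))" if u: "definable_term u" and w: "\<And>k. definable_term (w k)" for u w
    unfolding R_def
  proof (rule definable_ex_vec)
    fix \<sigma> :: "nat \<Rightarrow> nat" and l :: "'m \<Rightarrow> (nat \<Rightarrow> real) \<Rightarrow> real"
    assume l: "\<And>k. definable_term (l k)"
    note terms = definable_term_sum finite definable_term_mult definable_term_subst[OF l] l
      definable_term_var
      definable_term_const definable_term_subst[OF w] definable_term_subst[OF u] g
    show "definable (\<lambda>\<rho>. (\<forall>i. 0 \<le> (\<chi> k. l k \<rho>) $ i) \<and>
      flat_at (\<lambda>y. \<Sum>i\<in>UNIV. (\<chi> k. l k \<rho>) $ i * g i y) (\<chi> k. w k (\<lambda>i. \<rho> (\<sigma> i))) \<and>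
      (\<exists>i. 0 < (\<chi> k. l k \<rho>) $ i \<and> g i (\<chi> k. w k (\<lambda>i. \<rho> (\<sigma> i))) = u (\<lambda>i. \<rho> (\<sigma> i))) \<and>
      (\<forall>i. 0 < (\<chi> k. l k \<rho>) $ i \<longrightarrow> 0 < g i (\<chi> k. w k (\<lambda>i. \<rho> (\<sigma> i))) \<and>
        g i (\<chi> k. w k (\<lambda>i. \<rho> (\<sigma> i))) \<le> u (\<lambda>i. \<rho> (\<sigma> i))))"
      unfolding vec_lambda_beta
      by (intro definable_conj definable_finite_all definable_finite_ex definable_imp
        definable_le definable_less definable_eq
        definable_flat_at terms)
  qed

  \<comment> \<open>arbitrarily small \<open>t\<close> occur: take the largest constraint value in the support of the multipliers\<close>
  have "\<not> (\<forall>\<^sub>F t in at_right 0. \<not> (\<exists>x. R t x))"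
  proof
    assume "\<forall>\<^sub>F t in at_right 0. \<not> (\<exists>x. R t x)"
    then obtain \<epsilon> where \<epsilon>: "\<epsilon> > 0" "\<And>t x. 0 < t \<Longrightarrow> t < \<epsilon> \<Longrightarrow> \<not> R t x"
      unfolding eventually_at_right_field by auto
    obtain x and l :: "real ^ 'm" where l: "\<forall>i. 0 \<le> l $ i" "\<exists>i. 0 < l $ i"
      "flat_at (\<lambda>y. \<Sum>i\<in>UNIV. l $ i * g i y) x" "\<forall>i. 0 < l $ i \<longrightarrow> 0 < g i x \<and> g i x < \<epsilon>"
      using small[OF \<epsilon>(1)] unfolding critical_values_in_def greaterThanLessThan_iff by blast
    let ?V = "(\<lambda>i. g i x) ` {i. 0 < l $ i}"
    have V: "finite ?V" "?V \<noteq> {}" using l(2) by auto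
    obtain i where i: "0 < l $ i" "g i x = Max ?V" using Max_in[OF V] by auto
    have "g j x \<le> Max ?V" if "0 < l $ j" for j using that by (intro Max_ge V) auto
    then have "R (Max ?V) x" unfolding R_def using l i by (intro exI[of _ l]) metis
    moreover have "0 < Max ?V" "Max ?V < \<epsilon>" using l(4) i by metis+
    ultimately show False using \<epsilon>(2) by blast
  qed
  moreover have "definable (\<lambda>\<rho>. \<exists>x. R (\<rho> 0) x)"
    by (rule definable_ex_vec) (intro R definable_term_var)
  ultimately have ex: "\<forall>\<^sub>F t in at_right 0. \<exists>x. R t x"
    using at_right_dichotomy[of "\<lambda>t. \<exists>x. R t x" 0] by blast
  obtain u :: "'n \<Rightarrow> (nat \<Rightarrow> real) \<Rightarrow> real" where u: "\<And>k. definable_term (u k)"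
    "\<And>\<rho>. \<exists>x. R (\<rho> 0) x \<Longrightarrow> R (\<rho> 0) (\<chi> k. u k \<rho>)"
    using definable_choice_vec[of "\<lambda>\<rho>. R (\<rho> 0)"] R[OF definable_term_var] by blast
  \<comment> \<open>the chosen terms refer to variable \<open>0\<close> for \<open>t\<close>; giving all variables the value \<open>t\<close> leaves functions of \<open>t\<close> alone\<close>
  define \<xi> where "\<xi> k t = u k (\<lambda>_. t)" for k t
  define X where "X t = (\<chi> k. \<xi> k t)" for t
  define h where "h i t = g i (X t)" for i t
  have \<xi>: "definable_term (\<lambda>\<rho>. \<xi> k (\<rho> 0))" for k
    unfolding \<xi>_def by (rule definable_term_subst[OF u(1)])
  have h: "definable_term (\<lambda>\<rho>. h i (\<rho> 0))" for i
    unfolding h_def X_def by (intro g \<xi>)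
  have "\<forall>\<^sub>F t in at_right 0. R t (X t)"
    using ex by (rule eventually_mono) (use u(2)[of "\<lambda>_. _"] in \<open>simp add: X_def \<xi>_def\<close>)
  moreover have "\<forall>\<^sub>F t in at_right 0. \<forall>k. \<exists>C. \<forall>\<^sub>F s in at_right t. \<bar>\<xi> k s - \<xi> k t\<bar> \<le> C * (s - t)"
    by (intro eventually_all_finite right_lipschitz_near_zero \<xi>)
  moreover have "\<forall>\<^sub>F t in at_right 0. \<forall>i. 0 < h i t \<and> h i t \<le> t \<longrightarrow> (\<forall>\<^sub>F s in at_right t. h i t \<le> h i s)"
  proof (intro eventually_all_finite)
    fix i
    have "definable (\<lambda>\<rho>. 0 < h i (\<rho> 0) \<and> h i (\<rho> 0) \<le> \<rho> 0)"
      by (intro definability h)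
    from at_right_dichotomy[OF this, of 0]
    show "\<forall>\<^sub>F t in at_right 0. 0 < h i t \<and> h i t \<le> t \<longrightarrow> (\<forall>\<^sub>F s in at_right t. h i t \<le> h i s)"
    proof
      assume "\<forall>\<^sub>F t in at_right 0. 0 < h i t \<and> h i t \<le> t"
      from right_nondecreasing_near_zero[OF h this] show ?thesis by (rule eventually_mono) simp
    next
      assume "\<forall>\<^sub>F t in at_right 0. \<not> (0 < h i t \<and> h i t \<le> t)"
      then show ?thesis by (rule eventually_mono) blast
    qed
  qed
  moreover have "\<forall>\<^sub>F t in at_right 0. \<forall>i. h i t = t \<longrightarrow> (\<forall>\<^sub>F s in at_right t. h i s = s)"
  proof (intro eventually_all_finite)
    fix i
    have "definable (\<lambda>\<rho>. h i (\<rho> 0) = \<rho> 0)"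
      by (intro definability h)
    from at_right_dichotomy[OF this, of 0]
    show "\<forall>\<^sub>F t in at_right 0. h i t = t \<longrightarrow> (\<forall>\<^sub>F s in at_right t. h i s = s)"
    proof
      assume "\<forall>\<^sub>F t in at_right 0. h i t = t"
      then obtain d where d: "d > 0" "\<And>t. 0 < t \<Longrightarrow> t < d \<Longrightarrow> h i t = t"
        unfolding eventually_at_right_field by auto
      have "\<forall>\<^sub>F s in at_right t. h i s = s" if "0 < t" "t < d" for t
        unfolding eventually_at_right_field using that d(2) by (intro exI[of _ d]) auto
      then show ?thesis
        unfolding eventually_at_right_field[of _ 0] using d(1) by (intro exI[of _ d]) auto
    next
      assume "\<forall>\<^sub>F t in at_right 0. h i t \<noteq> t"
      then show ?thesis by (rule eventually_mono) simp
    qed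
  qed
  ultimately have "\<forall>\<^sub>F t in at_right 0. R t (X t) \<and>
      (\<forall>k. \<exists>C. \<forall>\<^sub>F s in at_right t. \<bar>\<xi> k s - \<xi> k t\<bar> \<le> C * (s - t)) \<and>
      (\<forall>i. 0 < h i t \<and> h i t \<le> t \<longrightarrow> (\<forall>\<^sub>F s in at_right t. h i t \<le> h i s)) \<and>
      (\<forall>i. h i t = t \<longrightarrow> (\<forall>\<^sub>F s in at_right t. h i s = s))"
    by (intro eventually_conj)
  then obtain t where Rt: "R t (X t)"
    and lip: "\<forall>k. \<exists>C. \<forall>\<^sub>F s in at_right t. \<bar>\<xi> k s - \<xi> k t\<bar> \<le> C * (s - t)"
    and mono: "\<And>i. 0 < h i t \<Longrightarrow> h i t \<le> t \<Longrightarrow> \<forall>\<^sub>F s in at_right t. h i t \<le> h i s"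
    and id: "\<And>i. h i t = t \<Longrightarrow> \<forall>\<^sub>F s in at_right t. h i s = s"
    using eventually_happens'[OF trivial_limit_at_right_real] by blast
  obtain l :: "real ^ 'm" and j where l: "\<And>i. 0 \<le> l $ i"
    "flat_at (\<lambda>y. \<Sum>i\<in>UNIV. l $ i * g i y) (X t)" "0 < l $ j" "h j t = t"
    "\<And>i. 0 < l $ i \<Longrightarrow> 0 < h i t \<and> h i t \<le> t"
    using Rt unfolding R_def h_def by blast
  obtain C where C: "\<And>k. \<forall>\<^sub>F s in at_right t. \<bar>\<xi> k s - \<xi> k t\<bar> \<le> C k * (s - t)"
    using choice[OF lip] by blast
  define D where "D = (\<Sum>k\<in>UNIV. \<bar>C k\<bar>) + 1"
  have D: "D > 0" unfolding D_def by (intro add_nonneg_pos sum_nonneg) auto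
  \<comment> \<open>chosen so that \<open>\<epsilon> * D\<close> is half of \<open>l $ j\<close>, the guaranteed growth rate\<close>
  define \<epsilon> where "\<epsilon> = l $ j / (2 * D)"
  have \<epsilon>: "\<epsilon> > 0" using l(3) D by (simp add: \<epsilon>_def)
  obtain \<eta> where \<eta>: "\<eta> > 0" "\<And>y. (\<Sum>k\<in>UNIV. \<bar>y $ k - X t $ k\<bar>) < \<eta> \<Longrightarrow>
      \<bar>(\<Sum>i\<in>UNIV. l $ i * g i y) - (\<Sum>i\<in>UNIV. l $ i * g i (X t))\<bar>
        \<le> \<epsilon> * (\<Sum>k\<in>UNIV. \<bar>y $ k - X t $ k\<bar>)"
    using l(2) \<epsilon> unfolding flat_at_def by meson
  have "\<forall>\<^sub>F s in at_right t. s \<in> {t<..<t + \<eta> / D}"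
    using \<eta>(1) D by (intro eventually_at_rightI) auto
  moreover have "\<forall>\<^sub>F s in at_right t. \<forall>k. \<bar>\<xi> k s - \<xi> k t\<bar> \<le> C k * (s - t)"
    by (intro eventually_all_finite C)
  moreover have "\<forall>\<^sub>F s in at_right t. \<forall>i. 0 < l $ i \<longrightarrow> h i t \<le> h i s"
  proof (intro eventually_all_finite)
    fix i
    show "\<forall>\<^sub>F s in at_right t. 0 < l $ i \<longrightarrow> h i t \<le> h i s"
      using mono[of i] l(5)[of i] by (cases "0 < l $ i") simp_all
  qed
  ultimately have "\<forall>\<^sub>F s in at_right t. h j s = s \<and> s \<in> {t<..<t + \<eta> / D} \<and>
      (\<forall>k. \<bar>\<xi> k s - \<xi> k t\<bar> \<le> C k * (s - t)) \<and> (\<forall>i. 0 < l $ i \<longrightarrow> h i t \<le> h i s)"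
    using id[OF l(4)] by (intro eventually_conj)
  then obtain s where s: "h j s = s" "s \<in> {t<..<t + \<eta> / D}"
    "\<And>k. \<bar>\<xi> k s - \<xi> k t\<bar> \<le> C k * (s - t)" "\<And>i. 0 < l $ i \<Longrightarrow> h i t \<le> h i s"
    using eventually_happens'[OF trivial_limit_at_right_real] by blast
  have "(\<Sum>k\<in>UNIV. \<bar>X s $ k - X t $ k\<bar>) \<le> (\<Sum>k\<in>UNIV. \<bar>C k\<bar> * (s - t))"
  proof (rule sum_mono)
    fix k
    have "C k * (s - t) \<le> \<bar>C k\<bar> * (s - t)" using s(2) by (intro mult_right_mono) auto
    then show "\<bar>X s $ k - X t $ k\<bar> \<le> \<bar>C k\<bar> * (s - t)" using s(3)[of k] by (simp add: X_def)
  qed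
  also have "\<dots> \<le> D * (s - t)"
    using s(2) unfolding sum_distrib_right[symmetric] by (intro mult_right_mono) (auto simp: D_def)
  finally have dist: "(\<Sum>k\<in>UNIV. \<bar>X s $ k - X t $ k\<bar>) \<le> D * (s - t)" .
  also have "D * (s - t) < \<eta>" using s(2) D by (simp add: field_simps)
  finally have "\<bar>(\<Sum>i\<in>UNIV. l $ i * h i s) - (\<Sum>i\<in>UNIV. l $ i * h i t)\<bar>
      \<le> \<epsilon> * (\<Sum>k\<in>UNIV. \<bar>X s $ k - X t $ k\<bar>)"
    unfolding h_def by (rule \<eta>(2))
  also have "\<dots> \<le> \<epsilon> * (D * (s - t))" using dist \<epsilon> by (intro mult_left_mono) auto
  also have "\<dots> = l $ j * (s - t) / 2" using D by (simp add: \<epsilon>_def)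
  finally have "(\<Sum>i\<in>UNIV. l $ i * h i s) - (\<Sum>i\<in>UNIV. l $ i * h i t) \<le> l $ j * (s - t) / 2"
    by (rule order.trans[OF abs_ge_self])
  then have upper: "(\<Sum>i\<in>UNIV. l $ i * (h i s - h i t)) \<le> l $ j * (s - t) / 2"
    by (simp only: right_diff_distrib sum_subtractf)
  have "l $ j * (h j s - h j t) \<le> (\<Sum>i\<in>UNIV. l $ i * (h i s - h i t))"
  proof (rule member_le_sum)
    fix i
    show "0 \<le> l $ i * (h i s - h i t)"
      using l(1)[of i] s(4)[of i] by (cases "l $ i = 0") auto
  qed auto
  then have "l $ j * (s - t) \<le> l $ j * (s - t) / 2" using upper s(1) l(4) by simp
  moreover have "0 < l $ j * (s - t)" using l(3) s(2) by simp
  ultimately show False by simp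
qed

end

section \<open>Regular perturbations\<close>

text \<open>If \<open>0\<close> is not in the convex hull of the active gradients, then a hyperplane strictly separates it from them, and its
normal, with the sign reversed, is a vector as required by the qualification. Otherwise the coefficients of a convex
combination equal to \<open>0\<close> are the multipliers.\<close>

lemma critical_values_if_not_MFCQ:
  fixes g :: "'m::finite \<Rightarrow> real ^ 'n::finite \<Rightarrow> real"
  assumes diff: "\<And>i. g i differentiable (at x)" and not: "\<not> MFCQ g \<mu> x"
    and \<mu>: "\<And>i. \<mu> $ i \<in> V"
  shows "critical_values_in g V"
proof -
  define G where "G i = gradient (g i) x" for i
  define I where "I = active g \<mu> x"
  have "0 \<in> convex hull (G ` I)"
  proof (rule ccontr)
    assume "0 \<notin> convex hull (G ` I)"
    moreover have "closed (convex hull (G ` I))"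
      by (intro compact_imp_closed finite_imp_compact_convex_hull) simp
    ultimately obtain a b where ab: "b > 0" "\<forall>v\<in>convex hull (G ` I). b < inner a v"
      using separating_hyperplane_closed_0[OF convex_convex_hull, of "G ` I"] by blast
    have "- a \<bullet> G i < 0" if "i \<in> I" for i
      using ab hull_inc[of "G i" "G ` I" convex] that by fastforce
    with not show False unfolding MFCQ_def G_def I_def by blast
  qed
  then obtain c where c: "\<forall>v\<in>G ` I. 0 \<le> c v" "sum c (G ` I) = 1" "(\<Sum>v\<in>G ` I. c v *\<^sub>R v) = 0"
    unfolding convex_hull_finite[OF finite_imageI[OF finite]] by auto
  \<comment> \<open>gradients of different constraints may coincide; \<open>J\<close> selects one index for each vector,
    and only these indices receive a positive multiplier\<close>
  define J where "J = inv_into I G ` (G ` I)"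
  have JI: "J \<subseteq> I" unfolding J_def by (auto intro: inv_into_into)
  have sum_J: "(\<Sum>i\<in>J. F (G i)) = (\<Sum>v\<in>G ` I. F v)" for F :: "real ^ 'n \<Rightarrow> 'b::comm_monoid_add"
    unfolding J_def sum.reindex[OF inj_on_inv_into[OF subset_refl]]
    by (rule sum.cong[OF refl]) (simp only: comp_apply f_inv_into_f)
  define l :: "real ^ 'm" where "l = (\<chi> i. if i \<in> J then c (G i) else 0)"
  have "(\<Sum>i\<in>UNIV. l $ i *\<^sub>R G i) = (\<Sum>i\<in>J. c (G i) *\<^sub>R G i)"
    by (rule sum.mono_neutral_cong_right) (auto simp: l_def)
  then have zero: "(\<Sum>i\<in>UNIV. l $ i *\<^sub>R G i) = 0"
    using sum_J[of "\<lambda>v. c v *\<^sub>R v"] c(3) by simp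
  have "((\<lambda>y. \<Sum>i\<in>UNIV. l $ i * g i y) has_derivative (\<lambda>v. \<Sum>i\<in>UNIV. l $ i * (v \<bullet> G i))) (at x)"
    using GDERIV_gradient[OF diff] unfolding gderiv_def G_def
    by (intro has_derivative_sum has_derivative_mult_right) auto
  moreover have "(\<Sum>i\<in>UNIV. l $ i * (v \<bullet> G i)) = v \<bullet> (\<Sum>i\<in>UNIV. l $ i *\<^sub>R G i)" for v
    by (simp add: inner_sum_right)
  ultimately have "flat_at (\<lambda>y. \<Sum>i\<in>UNIV. l $ i * g i y) x"
    by (intro flat_at_if_zero_derivative) (simp add: zero)
  moreover have "\<exists>i. 0 < l $ i"
  proof -
    have "\<exists>i\<in>J. c (G i) \<noteq> 0"
    proof (rule ccontr)
      assume "\<not> ?thesis"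
      then have "(\<Sum>i\<in>J. c (G i)) = 0" by simp
      with sum_J[of c] c(2) show False by simp
    qed
    then show ?thesis using c(1) JI by (force simp: l_def less_le)
  qed
  moreover have "\<forall>i. 0 \<le> l $ i" using c(1) JI by (auto simp: l_def)
  moreover have "g i x \<in> V" if "0 < l $ i" for i
  proof -
    have "i \<in> I" using that JI by (auto simp: l_def split: if_splits)
    then show ?thesis using \<mu>[of i] by (simp add: I_def active_def)
  qed
  ultimately show ?thesis unfolding critical_values_in_def by blast
qed

theorem theorem3p1:
  fixes S :: "nat \<Rightarrow> real list set set"
    and e :: "nat \<Rightarrow> 'n::finite"
    and g :: "'m::finite \<Rightarrow> real ^ 'n \<Rightarrow> real"
  assumes "o_minimal_structure S"
    and "bij_betw e {..<CARD('n)} UNIV"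
    and "\<And>i x. g i differentiable (at x)"
    and "\<And>i. definable_fun S e (g i)"
  shows "({x. \<forall>i. g i x \<le> 0} \<noteq> {} \<longrightarrow>
           (\<exists>\<epsilon>\<^sub>0>0. {\<mu>. \<forall>i. \<mu> $ i \<in> {0<..<\<epsilon>\<^sub>0}} \<subseteq> regular g)) \<and>
         ({x. \<forall>i. g i x < 0} \<noteq> {} \<longrightarrow>
           (\<exists>\<epsilon>\<^sub>1>0. {\<mu>. \<forall>i. \<mu> $ i \<in> {-\<epsilon>\<^sub>1<..<0}} \<subseteq> regular g))"
proof -
  interpret o_minimal_structure S by (rule assms(1))
  have g: "definable_term (\<lambda>\<rho>. g i (\<chi> k. w k \<rho>))" if "\<And>k. definable_term (w k)" for i w
    by (rule definable_term_fun[OF assms(2,4) that])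
  have "\<exists>\<epsilon>>0. \<not> critical_values_in g {0<..<\<epsilon>}"
    by (rule no_small_positive_critical_values) (rule g)
  then obtain \<epsilon> where \<epsilon>: "\<epsilon> > 0" "\<not> critical_values_in g {0<..<\<epsilon>}" by blast
  have "\<exists>\<delta>>0. \<not> critical_values_in (\<lambda>i x. - g i x) {0<..<\<delta>}"
    by (rule no_small_positive_critical_values) (intro definable_term_minus g)
  then obtain \<delta> where \<delta>: "\<delta> > 0" "\<not> critical_values_in g {-\<delta><..<0}"
    using critical_values_in_minus[of g "{-_<..<0}"] by auto
  have "{\<mu>. \<forall>i. \<mu> $ i \<in> {0<..<\<epsilon>}} \<subseteq> regular g" if ne: "{x. \<forall>i. g i x \<le> 0} \<noteq> {}"
  proof
    obtain x where x: "\<And>i. g i x \<le> 0" using ne by blast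
    fix \<mu> :: "real ^ 'm" assume "\<mu> \<in> {\<mu>. \<forall>i. \<mu> $ i \<in> {0<..<\<epsilon>}}"
    then have \<mu>: "\<mu> $ i \<in> {0<..<\<epsilon>}" for i by blast
    have "g i x \<le> \<mu> $ i" for i using x[of i] \<mu>[of i] by simp
    then have "x \<in> constraint_set g \<mu>" by (simp add: constraint_set_def)
    moreover have "MFCQ g \<mu> z" for z
      using critical_values_if_not_MFCQ[where g = g and V = "{0<..<\<epsilon>}", OF assms(3) _ \<mu>] \<epsilon>(2) by blast
    ultimately show "\<mu> \<in> regular g" by (auto simp: regular_def admissible_def)
  qed
  moreover have "\<exists>\<epsilon>\<^sub>1>0. {\<mu>. \<forall>i. \<mu> $ i \<in> {-\<epsilon>\<^sub>1<..<0}} \<subseteq> regular g" if ne: "{x. \<forall>i. g i x < 0} \<noteq> {}"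
  proof -
    obtain x where x: "\<And>i. g i x < 0" using ne by blast
    define \<epsilon>\<^sub>1 where "\<epsilon>\<^sub>1 = min \<delta> (Min (range (\<lambda>i. - g i x)))"
    have "\<epsilon>\<^sub>1 \<le> - g i x" for i
      unfolding \<epsilon>\<^sub>1_def by (intro min.coboundedI2 Min_le) auto
    note slater = this
    have "{\<mu>. \<forall>i. \<mu> $ i \<in> {-\<epsilon>\<^sub>1<..<0}} \<subseteq> regular g"
    proof
      fix \<mu> :: "real ^ 'm" assume "\<mu> \<in> {\<mu>. \<forall>i. \<mu> $ i \<in> {-\<epsilon>\<^sub>1<..<0}}"
      then have \<mu>: "\<mu> $ i \<in> {-\<epsilon>\<^sub>1<..<0}" for i by blast
      have "g i x \<le> \<mu> $ i" for i using slater[of i] \<mu>[of i] by simp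
      then have "x \<in> constraint_set g \<mu>" by (simp add: constraint_set_def)
      moreover have "\<epsilon>\<^sub>1 \<le> \<delta>" by (simp add: \<epsilon>\<^sub>1_def)
      then have "\<mu> $ i \<in> {-\<delta><..<0}" for i using \<mu>[of i] by simp
      then have "MFCQ g \<mu> z" for z
        using critical_values_if_not_MFCQ[where g = g and V = "{-\<delta><..<0}", OF assms(3)] \<delta>(2) by blast
      ultimately show "\<mu> \<in> regular g" by (auto simp: regular_def admissible_def)
    qed
    moreover have "\<epsilon>\<^sub>1 > 0" using \<delta>(1) x by (simp add: \<epsilon>\<^sub>1_def)
    ultimately show ?thesis by blast
  qed
  ultimately show ?thesis using \<epsilon>(1) by blast
qed

end
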